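(* There is a universal constant $C>0$ (the paper's $O(1)$) such that the following holds. Let $\Theta\subseteq\mathbb{R}^p\times\mathbb{R}$ with elements $\theta=(w,b)$, let $\nu$ be a probability distribution (density) over $\Theta$, let $\phi:\mathbb{R}\to\mathbb{R}$, write $\phi(x;\theta)=\phi(\langle x,w\rangle+b)$, let $B_\alpha>0$, and let $$\mathcal{V}=\left\{V_\alpha(\cdot)=\int_\Theta\alpha(\theta)\phi(\cdot;\theta)\,d\theta:\ \|V_\alpha\|_\nu:=\sup_{\theta\in\Theta}\left|\frac{\alpha(\theta)}{\nu(\theta)}\right|\le B_\alpha\right\}.$$ Suppose that $|\phi|\le1$, $\phi$ is $L_\phi$-Lipschitz, $\phi$ is differentiable, $\phi'$ is $L_{\phi'}$-Lipschitz, and $B_\theta:=\sup_{\theta\in\Theta}\|\theta\|$ is finite. Assume there is a compact set $S\subseteq\mathbb{R}^p$ such that $\varphi_t(\xi)\in S$ for all $\xi\in X$, $t\in T$, and let $B_S:=\sup_{x\in S}\|x\|$. Let $\gamma>0$, $\delta\in(0,1)$, and let $\xi_1,\dots,\xi_n$ be i.i.d. samples from $\mathcal{D}$. If the problem of finding $V\in\mathcal{V}$ such that $$h\left(\varphi_t(\xi_i),\dot\varphi_t(\xi_i),V(\varphi_t(\xi_i)),\tfrac{\partial V}{\partial x}(\varphi_t(\xi_i))\right)\le-\gamma,\qquad i=1,\dots,n,\ t\in T,$$ is feasible, then any solution $\hat V_n\in\mathcal{V}$ satisfies, with probability at least $1-\delta$ over $\xi_1,\dots,\xi_n$, $$\mathsf{err}(\hat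 V_n)\le C\left(B_\alpha^2(1+B_\theta L_\phi)^2L_h^2\,\frac{\kappa\log^3 n}{\gamma^2 n}+\frac{\log(\log(1+B_h/\gamma)/\delta)}{n}+\frac1{n^2}\right),$$ where $$\kappa:=\frac{B_\alpha^2L_h^2}{\gamma^2}\left((1+B_\theta L_\phi)^2\log n+B_\theta^2(B_S+1)^2(L_\phi+B_\theta L_{\phi'})^2\,p\right).$$
   Context: Setting. The dynamical system is $\dot x=f(x)$ with $f:\mathbb{R}^p\to\mathbb{R}^p$ continuous. $X\subseteq\mathbb{R}^p$ is compact, and $T\subseteq\mathbb{R}_+$ is the maximal interval starting at zero on which a unique solution $\varphi_t(\xi)$ with initial condition $\varphi_0(\xi)=\xi$ exists for all $\xi\in X$, $t\in T$. $\mathcal{D}$ is a probability distribution on $X$. $\dot\varphi_t(\xi)$ is the time derivative of $t\mapsto\varphi_t(\xi)$. $h:\mathbb{R}^p\times\mathbb{R}^p\times\mathbb{R}\times\mathbb{R}^{p}\to\mathbb{R}$ is a fixed known continuous function (certificates are scalar-valued, $V:\mathbb{R}^p\to\mathbb{R}$, continuously differentiable). Generalization error: for $V\in\mathcal{V}$, $$\mathsf{err}(V):=\mathbb{P}_{\xi\sim\mathcal{D}}\left\{\max_{t\in T}h\left(\varphi_t(\xi),\dot\varphi_t(\xi),V(\varphi_t(\xi)),\tfrac{\partial V}{\partial x}(\varphi_t(\xi))\right)>0\right\};$$ the probability is over a fresh $\xi$, with $V$ fixed. Constants: $B_V,B_{\nabla V}$ are finite constants with $\sup_{V\in\mathcal{V}}\sup_{x\in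 S}|V(x)|\le B_V$ and $\sup_{V\in\mathcal{V}}\sup_{x\in S}\|\frac{\partial V}{\partial x}(x)\|\le B_{\nabla V}$ (for the class in the claim one may take $B_V=B_\alpha$, $B_{\nabla V}=B_\alpha B_\theta L_\phi$). $B_h$ is a (finite) upper bound on $|h(x,f(x),v,w)|$ over $x\in S$, $|v|\le B_V$, $\|w\|\le B_{\nabla V}$; $L_h$ is a (finite) upper bound, valid for all $x\in S$, on the Lipschitz constant of $(v,w)\mapsto h(x,f(x),v,w)$ over $|v|\le B_V$, $\|w\|\le B_{\nabla V}$. $\|\cdot\|$ is the Euclidean norm. *)

theory Defs
  imports "HOL-Probability.Probability"
begin

text \<open>
  The constant of the theorem is universal, in particular independent of the dimension \<open>p\<close>. The
  dimension therefore has to be bound inside the formula and cannot be a type. Points of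
  \<open>\<real>\<^sup>p\<close> are functions \<open>nat \<Rightarrow> real\<close> that are extensional on \<open>{..<p}\<close>, i.e. the points of the
  space of \<open>Pi\<^sub>M {..<p} (\<lambda>_. borel)\<close>. The library's product topology on \<open>nat \<Rightarrow> real\<close> restricts to
  the Euclidean topology on this set, so \<open>continuous_on\<close> and \<open>compact\<close> have their usual meaning.
\<close>

type_synonym vec = "nat \<Rightarrow> real"

definition Rn :: "nat \<Rightarrow> vec set" where
  "Rn p = (\<Pi>\<^sub>E i\<in>{..<p}. UNIV)"

definition inner_vec :: "nat \<Rightarrow> vec \<Rightarrow> vec \<Rightarrow> real" where
  "inner_vec p x y = (\<Sum>i<p. x i * y i)"

definition norm_vec :: "nat \<Rightarrow> vec \<Rightarrow> real" where
  "norm_vec p x = L2_set x {..<p}"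

definition norm_pair :: "nat \<Rightarrow> vec \<times> real \<Rightarrow> real" where
  "norm_pair p \<theta> = sqrt ((norm_vec p (fst \<theta>))\<^sup>2 + (snd \<theta>)\<^sup>2)"

definition grad :: "nat \<Rightarrow> (vec \<Rightarrow> real) \<Rightarrow> vec \<Rightarrow> vec" where
  "grad p V x = (\<lambda>i\<in>{..<p}. deriv (\<lambda>s. V (x(i := s))) (x i))"

text \<open>
  Initial value problem on a time set \<open>T\<close>; derivatives at endpoints belonging to \<open>T\<close> are one-sided.
\<close>

definition solves_ivp :: "nat \<Rightarrow> (vec \<Rightarrow> vec) \<Rightarrow> real set \<Rightarrow> vec \<Rightarrow> (real \<Rightarrow> vec) \<Rightarrow> bool" where
  "solves_ivp p f T \<xi> x \<longleftrightarrow>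
     x 0 = \<xi> \<and> (\<forall>t\<in>T. x t \<in> Rn p) \<and>
     (\<forall>t\<in>T. \<forall>i<p. ((\<lambda>s. x s i) has_real_derivative f (x t) i) (at t within T))"

text \<open>
  The degenerate interval \<open>{0}\<close> is excluded since the time derivative makes no sense on it.
\<close>

definition time_interval :: "real set \<Rightarrow> bool" where
  "time_interval T \<longleftrightarrow> is_interval T \<and> T \<subseteq> {0..} \<and> 0 \<in> T \<and> T \<noteq> {0}"

definition unique_solutions_on :: "nat \<Rightarrow> (vec \<Rightarrow> vec) \<Rightarrow> vec set \<Rightarrow> real set \<Rightarrow> bool" where
  "unique_solutions_on p f X T \<longleftrightarrow>
     (\<forall>\<xi>\<in>X. \<exists>x. solves_ivp p f T \<xi> x \<and> (\<forall>y. solves_ivp p f T \<xi> y \<longrightarrow> (\<forall>t\<in>T. y t = x t)))"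

text \<open>
  Intervals starting at zero are totally ordered by inclusion, so the maximal one is the greatest.
\<close>

definition maximal_interval :: "nat \<Rightarrow> (vec \<Rightarrow> vec) \<Rightarrow> vec set \<Rightarrow> real set \<Rightarrow> bool" where
  "maximal_interval p f X T \<longleftrightarrow>
     time_interval T \<and> unique_solutions_on p f X T \<and>
     (\<forall>T'. time_interval T' \<and> unique_solutions_on p f X T' \<longrightarrow> T' \<subseteq> T)"

definition time_deriv :: "nat \<Rightarrow> real set \<Rightarrow> (real \<Rightarrow> vec) \<Rightarrow> real \<Rightarrow> vec" where
  "time_deriv p T x t = (\<lambda>i\<in>{..<p}. vector_derivative (\<lambda>s. x s i) (at t within T))"

text \<open>
  The quantity \<open>h(\<phi>\<^sub>t(\<xi>), d/dt \<phi>\<^sub>t(\<xi>), V(\<phi>\<^sub>t(\<xi>)), \<partial>V/\<partial>x(\<phi>\<^sub>t(\<xi>)))\<close>, where \<open>\<Phi> t \<xi>\<close> is the flow.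
\<close>

definition cert ::
  "nat \<Rightarrow> (vec \<Rightarrow> vec \<Rightarrow> real \<Rightarrow> vec \<Rightarrow> real) \<Rightarrow> real set \<Rightarrow> (real \<Rightarrow> vec \<Rightarrow> vec) \<Rightarrow>
   (vec \<Rightarrow> real) \<Rightarrow> vec \<Rightarrow> real \<Rightarrow> real" where
  "cert p h T \<Phi> V \<xi> t =
     h (\<Phi> t \<xi>) (time_deriv p T (\<lambda>s. \<Phi> s \<xi>) t) (V (\<Phi> t \<xi>)) (grad p V (\<Phi> t \<xi>))"

text \<open>
  The maximum over \<open>T\<close> is a supremum. It is positive iff some value is positive, so it does not
  matter whether it is attained (the values are bounded in the theorem).
\<close>

definition err ::
  "nat \<Rightarrow> (vec \<Rightarrow> vec \<Rightarrow> real \<Rightarrow> vec \<Rightarrow> real) \<Rightarrow> real set \<Rightarrow> (real \<Rightarrow> vec \<Rightarrow> vec) \<Rightarrow>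
   vec measure \<Rightarrow> (vec \<Rightarrow> real) \<Rightarrow> real" where
  "err p h T \<Phi> D V = measure D {\<xi>\<in>space D. (SUP t\<in>T. cert p h T \<Phi> V \<xi> t) > 0}"

text \<open>Lebesgue measure on \<open>\<real>\<^sup>p \<times> \<real>\<close>.\<close>

definition param_leb :: "nat \<Rightarrow> (vec \<times> real) measure" where
  "param_leb p = (\<Pi>\<^sub>M i\<in>{..<p}. lborel) \<Otimes>\<^sub>M lborel"

definition prob_density_on :: "nat \<Rightarrow> (vec \<times> real) set \<Rightarrow> (vec \<times> real \<Rightarrow> real) \<Rightarrow> bool" where
  "prob_density_on p \<Theta> \<nu> \<longleftrightarrow>
     (\<forall>\<theta>\<in>\<Theta>. 0 \<le> \<nu> \<theta>) \<and> set_integrable (param_leb p) \<Theta> \<nu> \<and>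
     (LINT \<theta>:\<Theta>|param_leb p. \<nu> \<theta>) = 1"

text \<open>
  Division in \<^typ>\<open>ennreal\<close> rather than \<^typ>\<open>real\<close>: \<open>\<bar>\<alpha>\<bar> / \<nu>\<close> is infinite where \<open>\<nu> = 0 \<noteq> \<alpha>\<close>, and
  zero where \<open>\<nu> = 0 = \<alpha>\<close>.
\<close>

definition nu_norm :: "(vec \<times> real) set \<Rightarrow> (vec \<times> real \<Rightarrow> real) \<Rightarrow> (vec \<times> real \<Rightarrow> real) \<Rightarrow> ennreal" where
  "nu_norm \<Theta> \<nu> \<alpha> = (SUP \<theta>\<in>\<Theta>. ennreal \<bar>\<alpha> \<theta>\<bar> / ennreal (\<nu> \<theta>))"

definition V_of ::
  "nat \<Rightarrow> (vec \<times> real) set \<Rightarrow> (real \<Rightarrow> real) \<Rightarrow> (vec \<times> real \<Rightarrow> real) \<Rightarrow> vec \<Rightarrow> real" where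
  "V_of p \<Theta> \<phi> \<alpha> x =
     (LINT \<theta>:\<Theta>|param_leb p. \<alpha> \<theta> * \<phi> (inner_vec p x (fst \<theta>) + snd \<theta>))"

definition V_class ::
  "nat \<Rightarrow> (vec \<times> real) set \<Rightarrow> (vec \<times> real \<Rightarrow> real) \<Rightarrow> (real \<Rightarrow> real) \<Rightarrow> real \<Rightarrow> (vec \<Rightarrow> real) set" where
  "V_class p \<Theta> \<nu> \<phi> B\<alpha> =
     {V_of p \<Theta> \<phi> \<alpha> | \<alpha>. set_borel_measurable (param_leb p) \<Theta> \<alpha> \<and> nu_norm \<Theta> \<nu> \<alpha> \<le> ennreal B\<alpha>}"

text \<open>
  Logarithms are taken to base 2. A change of base only affects the universal constant, except in
  the nested logarithm. There base 2 guarantees \<open>log 2 (1 + B\<^sub>h/\<gamma>) \<ge> 1\<close> whenever \<open>B\<^sub>h \<ge> \<gamma>\<close> (which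
  feasibility on a nonempty sample forces), so that the confidence term is nonnegative for every \<open>\<delta> < 1\<close>. With natural
  logarithms it can be negative and exceed \<open>1/n\<^sup>2\<close> in absolute value.
\<close>

definition kappa ::
  "nat \<Rightarrow> nat \<Rightarrow> real \<Rightarrow> real \<Rightarrow> real \<Rightarrow> real \<Rightarrow> real \<Rightarrow> real \<Rightarrow> real \<Rightarrow> real" where
  "kappa p n B\<alpha> Lh \<gamma> B\<theta> L\<phi> L\<phi>' BS =
     B\<alpha>\<^sup>2 * Lh\<^sup>2 / \<gamma>\<^sup>2 *
       ((1 + B\<theta> * L\<phi>)\<^sup>2 * log 2 n + B\<theta>\<^sup>2 * (BS + 1)\<^sup>2 * (L\<phi> + B\<theta> * L\<phi>')\<^sup>2 * p)"

end

theory Submission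
  imports Defs
begin

text \<open>
  If the class is split into \<open>N\<close> cells such that the certificate values of two members of a cell
  differ by less than \<open>\<gamma>\<close> along all trajectories, then a union bound over the cells shows that every
  \<open>V\<close> with margin \<open>\<gamma>\<close> on the sample has error at most \<open>ln (N/\<delta>) / n\<close>. Members of the class are
  \<open>V x = E[c(\<theta>) \<phi>(\<langle>x, w\<rangle> + b)]\<close> with \<open>\<theta> = (w, b)\<close> drawn from \<open>\<nu>\<close> and \<open>\<bar>c\<bar> \<le> B\<^sub>\<alpha>\<close>.

  To bound \<open>N\<close>, take a packing of the coefficients \<open>c\<close> that is separated in the values of \<open>V\<close> on a
  finite grid. By Hoeffding's inequality, \<open>k\<close> random features estimate all these values well for
  at least half of the packing simultaneously, as soon as \<open>k\<close> exceeds a multiple of the logarithm of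
  the grid size. These members are then determined by their \<open>k\<close> coefficients up to a small error, so
  their number is at most exponential in \<open>k\<close>. Closeness of the gradients follows from closeness of
  the values on a slightly larger ball, since the gradients are Lipschitz.
\<close>

subsection \<open>Covering linear classes by random features\<close>

text \<open>The size of the packing is the quantity to be bounded, so a union bound over grid points
  and packing members together would be circular. Instead failure has probability at most 1/2 for
  each single member, and averaging over the members yields one draw of features that serves half of
  them. The number of features then depends on the grid only through the logarithm of its size,
  which is how the dimension enters linearly, up to logarithms.

  These logarithms contain the scales of the class. They become multiples of \<open>log 2 n\<close>
  because the claim is trivial unless its complexity term is at most 1, and then the scales are
  dominated by \<open>n\<close>. One factor \<open>log 2 n\<close> stems from the grid, another from
  the number of values of a rounded coefficient.

  The margin enters as follows: if a certificate value of one member is positive, then every member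
  of the same cell has a value above \<open>- \<gamma>\<close> at the same time and initial point. A
  sample on which the latter is feasible has therefore missed the violation set of the
  former.\<close>

lemma hoeffding_sample_mean:
  fixes g :: "'a \<Rightarrow> real" and k :: nat and t :: real
  assumes "prob_space Q" and [measurable]: "g \<in> borel_measurable Q"
    and bound: "\<And>x. \<bar>g x\<bar> \<le> B" and "0 < B" "0 < k" "0 \<le> t"
  shows "measure (\<Pi>\<^sub>M j\<in>{..<k}. Q)
           {\<omega>\<in>space (\<Pi>\<^sub>M j\<in>{..<k}. Q). t \<le> \<bar>(\<Sum>j<k. g (\<omega> j)) / k - (\<integral>x. g x \<partial>Q)\<bar>}
         \<le> 2 * exp (- (k * t\<^sup>2 / (2 * B\<^sup>2)))"
proof -
  interpret Q: prob_space Q by fact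
  define P where "P = (\<Pi>\<^sub>M j\<in>{..<k}. Q)"
  interpret P: prob_space P
    unfolding P_def by (intro prob_space_PiM assms(1))
  have comp: "distr P Q (\<lambda>\<omega>. \<omega> j) = Q" if "j < k" for j
    unfolding P_def using distr_PiM_component[of "{..<k}" "\<lambda>_. Q" j] assms(1) that by simp
  have [measurable]: "(\<lambda>\<omega>. \<omega> j) \<in> P \<rightarrow>\<^sub>M Q" if "j < k" for j
    unfolding P_def using that by simp
  \<comment> \<open>The joint law of the coordinates is \<open>P\<close> itself, which is the
    product of the marginals.\<close>
  have "P.indep_vars (\<lambda>_. Q) (\<lambda>j \<omega>. \<omega> j) {..<k}"
  proof (subst P.indep_vars_iff_distr_eq_PiM')
    have "distr P (\<Pi>\<^sub>M j\<in>{..<k}. Q) (\<lambda>\<omega>. \<lambda>j\<in>{..<k}. \<omega> j) = distr P P (\<lambda>\<omega>. \<omega>)"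
      by (rule distr_cong) (auto simp: P_def space_PiM)
    also have "\<dots> = P"
      by (simp add: distr_id2)
    also have "\<dots> = (\<Pi>\<^sub>M j\<in>{..<k}. distr P Q (\<lambda>\<omega>. \<omega> j))"
      unfolding P_def by (intro PiM_cong) (auto simp: comp[unfolded P_def])
    finally show "distr P (\<Pi>\<^sub>M j\<in>{..<k}. Q) (\<lambda>\<omega>. \<lambda>j\<in>{..<k}. \<omega> j)
        = (\<Pi>\<^sub>M j\<in>{..<k}. distr P Q (\<lambda>\<omega>. \<omega> j))" .
  qed (use \<open>0 < k\<close> in auto)
  then have indep: "P.indep_vars (\<lambda>_. borel) (\<lambda>j \<omega>. g (\<omega> j)) {..<k}"
    by (rule P.indep_vars_compose2) auto
  have distr_g: "distr P borel (\<lambda>\<omega>. g (\<omega> j)) = distr Q borel g" if "j < k" for j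
  proof -
    have "distr Q borel g = distr (distr P Q (\<lambda>\<omega>. \<omega> j)) borel g"
      by (simp add: comp that)
    also have "\<dots> = distr P borel (\<lambda>\<omega>. g (\<omega> j))"
      by (subst distr_distr) (use that in \<open>auto simp: comp_def\<close>)
    finally show ?thesis ..
  qed
  have mean: "P.expectation (\<lambda>\<omega>. g (\<omega> 0)) = (\<integral>x. g x \<partial>Q)"
  proof -
    have "(\<integral>x. g x \<partial>Q) = (\<integral>x. g x \<partial>distr P Q (\<lambda>\<omega>. \<omega> 0))"
      using \<open>0 < k\<close> by (simp add: comp)
    also have "\<dots> = P.expectation (\<lambda>\<omega>. g (\<omega> 0))"
      by (rule integral_distr) (use \<open>0 < k\<close> in auto)
    finally show ?thesis ..
  qed
  interpret Hoeffding_ineq_iid P "{..<k}" "\<lambda>j \<omega>. g (\<omega> j)" "\<lambda>\<omega>. g (\<omega> 0)" "- B" B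
      "P.expectation (\<lambda>\<omega>. g (\<omega> 0))"
  proof unfold_locales
    show "AE x in P. g (x 0) \<in> {- B..B}"
      using bound by (auto simp: abs_le_iff intro!: AE_I2) (smt (verit) bound)
  qed (use indep distr_g \<open>0 < k\<close> in auto)
  have "P.prob {\<omega>\<in>space P. t \<le> \<bar>(\<Sum>j<k. g (\<omega> j)) / card {..<k} - P.expectation (\<lambda>\<omega>. g (\<omega> 0))\<bar>}
      \<le> 2 * exp (- 2 * real (card {..<k}) * t\<^sup>2 / (B - - B)\<^sup>2)"
    by (rule Hoeffding_ineq_abs_ge') (use \<open>0 \<le> t\<close> \<open>0 < B\<close> \<open>0 < k\<close> in auto)
  \<comment> \<open>The values lie in an interval of length \<open>2 * B\<close>, so the exponent is
    \<open>2 * k * t\<^sup>2 / (2 * B)\<^sup>2\<close>.\<close>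
  also have "- 2 * real (card {..<k}) * t\<^sup>2 / (B - - B)\<^sup>2 = - (k * t\<^sup>2 / (2 * B\<^sup>2))"
    using \<open>0 < B\<close> by (simp add: power2_eq_square field_simps)
  finally show ?thesis
    unfolding mean by (simp add: P_def)
qed

text \<open>In the application \<open>Z\<close> consists of the features
  \<open>\<phi> (arg y \<theta>)\<close>, as functions of \<theta>, at the points \<open>y\<close>
  of a finite grid. The integrals are then values of certificates on the grid.\<close>

definition feature_sep :: "'a measure \<Rightarrow> ('a \<Rightarrow> real) set \<Rightarrow> real \<Rightarrow> ('a \<Rightarrow> real) \<Rightarrow> ('a \<Rightarrow> real) \<Rightarrow> bool"
  where "feature_sep Q Z \<epsilon> c c' \<longleftrightarrow> (\<exists>y\<in>Z. \<epsilon> < \<bar>(\<integral>\<theta>. c \<theta> * y \<theta> \<partial>Q) - (\<integral>\<theta>. c' \<theta> * y \<theta> \<partial>Q)\<bar>)"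

text \<open>The expected number of bad \<open>c\<close> is at most half of \<open>card F\<close>,
  and some outcome does not exceed the expectation.\<close>

lemma (in prob_space) exists_few_bad:
  assumes "finite F" and meas: "\<And>c. c \<in> F \<Longrightarrow> Bad c \<in> sets M"
    and half: "\<And>c. c \<in> F \<Longrightarrow> prob (Bad c) \<le> 1 / 2"
  shows "\<exists>\<omega>\<in>space M. 2 * card {c\<in>F. \<omega> \<in> Bad c} \<le> card F"
proof (rule ccontr)
  assume "\<not> ?thesis"
  \<comment> \<open>Integrality gives a gap of 1, so the weak inequality between expectations
    already yields a contradiction.\<close>
  then have many: "card F + 1 \<le> 2 * card {c\<in>F. \<omega> \<in> Bad c}" if "\<omega> \<in> space M" for \<omega>
    using that by force
  have [measurable]: "\<And>c. c \<in> F \<Longrightarrow> Bad c \<in> sets M" by (rule meas)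
  have int: "integrable M (\<lambda>\<omega>. \<Sum>c\<in>F. indicator (Bad c) \<omega> :: real)"
    by (intro Bochner_Integration.integrable_sum integrable_const_bound[of _ 1]) 
       (auto simp: indicator_def)
  have "(real (card F) + 1) / 2 = expectation (\<lambda>_. (real (card F) + 1) / 2)"
    by (simp add: prob_space)
  also have "\<dots> \<le> expectation (\<lambda>\<omega>. \<Sum>c\<in>F. indicator (Bad c) \<omega>)"
  proof (rule integral_mono[OF _ int])
    fix \<omega> assume "\<omega> \<in> space M"
    have "(\<Sum>c\<in>F. indicator (Bad c) \<omega>) = real (card {c\<in>F. \<omega> \<in> Bad c})"
      using \<open>finite F\<close> by (simp add: indicator_def sum.If_cases Int_def)
    with many[OF \<open>\<omega> \<in> space M\<close>] show "(real (card F) + 1) / 2 \<le> (\<Sum>c\<in>F. indicator (Bad c) \<omega>)"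
      by simp
  qed simp
  also have "\<dots> = (\<Sum>c\<in>F. prob (Bad c))"
    by (subst Bochner_Integration.integral_sum) (auto intro!: integrable_const_bound[of _ 1] simp: indicator_def meas sets.sets_into_space Int_absorb2)
  also have "\<dots> \<le> (\<Sum>c\<in>F. 1 / 2)"
    by (intro sum_mono half)
  finally show False by simp
qed

text \<open>Take a draw whose empirical means are within \<open>\<epsilon> / 4\<close> of the
  integrals on all of \<open>Z\<close> for at least half of \<open>F\<close>. On this half, rounding
  the coefficients at the \<open>k\<close> drawn parameters to cells of width
  \<open>\<epsilon> / 2\<close> is injective: equal roundings would bring two integrals closer than
  \<open>\<epsilon> / 4 + \<epsilon> / 2 + \<epsilon> / 4\<close>. What remains is to count the
  roundings.\<close>

lemma feature_packing_bound:
  fixes F Z :: "('a \<Rightarrow> real) set"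
  assumes "prob_space Q" "finite F" "finite Z" "0 < \<epsilon>" "0 < B" "0 < k"
    and F: "\<And>c. c \<in> F \<Longrightarrow> c \<in> borel_measurable Q" "\<And>c \<theta>. c \<in> F \<Longrightarrow> \<bar>c \<theta>\<bar> \<le> B"
    and Z: "\<And>y. y \<in> Z \<Longrightarrow> y \<in> borel_measurable Q" "\<And>y \<theta>. y \<in> Z \<Longrightarrow> \<bar>y \<theta>\<bar> \<le> 1"
    and k: "4 * card Z * exp (- (k * \<epsilon>\<^sup>2 / (32 * B\<^sup>2))) \<le> 1"
    and sep: "\<And>c c'. c \<in> F \<Longrightarrow> c' \<in> F \<Longrightarrow> c \<noteq> c' \<Longrightarrow> feature_sep Q Z \<epsilon> c c'"
  shows "card F \<le> 2 * (4 * B / \<epsilon> + 3) ^ k"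
proof -
  define P where "P = (\<Pi>\<^sub>M j\<in>{..<k}. Q)"
  interpret P: prob_space P
    unfolding P_def by (intro prob_space_PiM assms(1))
  define emp where "emp c y \<omega> = (\<Sum>j<k. c (\<omega> j) * y (\<omega> j)) / k"
    for c y :: "'a \<Rightarrow> real" and \<omega> :: "nat \<Rightarrow> 'a"
  define dev where "dev c y = {\<omega>\<in>space P. \<epsilon> / 4 \<le> \<bar>emp c y \<omega> - (\<integral>\<theta>. c \<theta> * y \<theta> \<partial>Q)\<bar>}" for c y
  define Bad where "Bad c = (\<Union>y\<in>Z. dev c y)" for c
  have comp: "(\<lambda>\<omega>. \<omega> j) \<in> P \<rightarrow>\<^sub>M Q" if "j < k" for j
    unfolding P_def using that by simp
  have dev_sets: "dev c y \<in> sets P" if "c \<in> F" "y \<in> Z" for c y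
  proof -
    have [measurable]: "c \<in> borel_measurable Q" "y \<in> borel_measurable Q"
      by (rule F(1) Z(1), rule that)+
    have "(\<lambda>\<omega>. c (\<omega> j) * y (\<omega> j)) \<in> borel_measurable P" if "j < k" for j
      by (intro borel_measurable_times measurable_compose[OF comp]) (use that in measurable)
    then have [measurable]: "emp c y \<in> borel_measurable P"
      unfolding emp_def by (intro borel_measurable_divide borel_measurable_sum) auto
    show ?thesis unfolding dev_def by measurable
  qed
  have cy: "\<bar>c \<theta> * y \<theta>\<bar> \<le> B" if "c \<in> F" "y \<in> Z" for c y \<theta>
    using mult_mono[OF F(2)[OF that(1), of \<theta>] Z(2)[OF that(2), of \<theta>]] \<open>0 < B\<close>
    by (simp add: abs_mult)
  have dev_prob: "P.prob (dev c y) \<le> 2 * exp (- (k * \<epsilon>\<^sup>2 / (32 * B\<^sup>2)))"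
    if "c \<in> F" "y \<in> Z" for c y
  proof -
    have "P.prob (dev c y) \<le> 2 * exp (- (k * (\<epsilon> / 4)\<^sup>2 / (2 * B\<^sup>2)))"
      unfolding dev_def emp_def P_def
      by (rule hoeffding_sample_mean)
         (use assms(1) that F Z cy \<open>0 < B\<close> \<open>0 < k\<close> \<open>0 < \<epsilon>\<close> in auto)
    also have "k * (\<epsilon> / 4)\<^sup>2 / (2 * B\<^sup>2) = k * \<epsilon>\<^sup>2 / (32 * B\<^sup>2)"
      by (simp add: power_divide)
    finally show ?thesis .
  qed
  have "\<exists>\<omega>\<in>space P. 2 * card {c\<in>F. \<omega> \<in> Bad c} \<le> card F"
  proof (rule P.exists_few_bad[OF \<open>finite F\<close>])
    fix c assume "c \<in> F"
    show "Bad c \<in> sets P"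
      unfolding Bad_def using \<open>finite Z\<close> dev_sets[OF \<open>c \<in> F\<close>] by auto
    have "P.prob (Bad c) \<le> (\<Sum>y\<in>Z. P.prob (dev c y))"
      unfolding Bad_def using \<open>finite Z\<close> dev_sets[OF \<open>c \<in> F\<close>]
      by (intro P.finite_measure_subadditive_finite) auto
    also have "\<dots> \<le> (\<Sum>y\<in>Z. 2 * exp (- (k * \<epsilon>\<^sup>2 / (32 * B\<^sup>2))))"
      by (intro sum_mono dev_prob \<open>c \<in> F\<close>)
    \<comment> \<open>This is the origin of the factor 4 in \<open>k\<close>: 2 from the two-sided
      tail, 2 from the target probability 1/2.\<close>
    also have "\<dots> \<le> 1 / 2" using k by simp
    finally show "P.prob (Bad c) \<le> 1 / 2" .
  qed
  then obtain \<omega> where \<omega>: "\<omega> \<in> space P" "2 * card {c\<in>F. \<omega> \<in> Bad c} \<le> card F" ..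
  define G where "G = {c\<in>F. \<omega> \<notin> Bad c}"
  have "card F = card G + card {c\<in>F. \<omega> \<in> Bad c}"
    unfolding G_def using \<open>finite F\<close>
    by (subst card_Un_disjoint[symmetric]) (auto intro!: arg_cong[where f = card])
  with \<omega>(2) have G_large: "card F \<le> 2 * card G" by simp
  define disc where "disc c = (\<lambda>j\<in>{..<k}. \<lfloor>2 * c (\<omega> j) / \<epsilon>\<rfloor>)" for c :: "'a \<Rightarrow> real"
  define I where "I = {\<lfloor>- (2 * B / \<epsilon>)\<rfloor>..\<lfloor>2 * B / \<epsilon>\<rfloor>}"
  have "inj_on disc G"
  proof (rule inj_onI, rule ccontr)
    fix c c' assume cc': "c \<in> G" "c' \<in> G" "disc c = disc c'" "c \<noteq> c'"
    then obtain y where y: "y \<in> Z" "\<epsilon> < \<bar>(\<integral>\<theta>. c \<theta> * y \<theta> \<partial>Q) - (\<integral>\<theta>. c' \<theta> * y \<theta> \<partial>Q)\<bar>"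
      using sep unfolding G_def feature_sep_def by blast
    have close: "\<bar>c (\<omega> j) - c' (\<omega> j)\<bar> \<le> \<epsilon> / 2" if "j < k" for j
    proof -
      have "\<lfloor>2 * c (\<omega> j) / \<epsilon>\<rfloor> = \<lfloor>2 * c' (\<omega> j) / \<epsilon>\<rfloor>"
        using fun_cong[OF cc'(3), of j] that by (simp add: disc_def)
      then have "\<bar>2 * c (\<omega> j) / \<epsilon> - 2 * c' (\<omega> j) / \<epsilon>\<bar> \<le> 1" by linarith
      then have "\<epsilon> / 2 * \<bar>2 * c (\<omega> j) / \<epsilon> - 2 * c' (\<omega> j) / \<epsilon>\<bar> \<le> \<epsilon> / 2 * 1"
        using \<open>0 < \<epsilon>\<close> by (intro mult_left_mono) auto
      moreover have "c (\<omega> j) - c' (\<omega> j) = \<epsilon> / 2 * (2 * c (\<omega> j) / \<epsilon> - 2 * c' (\<omega> j) / \<epsilon>)"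
        using \<open>0 < \<epsilon>\<close> by (simp add: field_simps)
      then have "\<bar>c (\<omega> j) - c' (\<omega> j)\<bar> = \<epsilon> / 2 * \<bar>2 * c (\<omega> j) / \<epsilon> - 2 * c' (\<omega> j) / \<epsilon>\<bar>"
        using \<open>0 < \<epsilon>\<close> by (metis abs_mult abs_of_pos half_gt_zero)
      ultimately show ?thesis by simp
    qed
    have "\<bar>emp c y \<omega> - emp c' y \<omega>\<bar> = \<bar>\<Sum>j<k. (c (\<omega> j) - c' (\<omega> j)) * y (\<omega> j)\<bar> / k"
      by (simp add: emp_def sum_subtractf left_diff_distrib abs_divide flip: diff_divide_distrib)
    also have "\<dots> \<le> (\<Sum>j<k. \<epsilon> / 2) / k"
    proof (intro divide_right_mono order_trans[OF sum_abs] sum_mono)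
      fix j assume "j \<in> {..<k}"
      then have "\<bar>c (\<omega> j) - c' (\<omega> j)\<bar> * \<bar>y (\<omega> j)\<bar> \<le> \<epsilon> / 2 * 1"
        using close Z(2)[OF y(1)] \<open>0 < \<epsilon>\<close> by (intro mult_mono) auto
      then show "\<bar>(c (\<omega> j) - c' (\<omega> j)) * y (\<omega> j)\<bar> \<le> \<epsilon> / 2" by (simp add: abs_mult)
    qed simp
    also have "\<dots> = \<epsilon> / 2" using \<open>0 < k\<close> by simp
    finally have "\<bar>emp c y \<omega> - emp c' y \<omega>\<bar> \<le> \<epsilon> / 2" .
    moreover have "\<bar>emp c y \<omega> - (\<integral>\<theta>. c \<theta> * y \<theta> \<partial>Q)\<bar> < \<epsilon> / 4"
        "\<bar>emp c' y \<omega> - (\<integral>\<theta>. c' \<theta> * y \<theta> \<partial>Q)\<bar> < \<epsilon> / 4"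
      using cc'(1,2) y(1) \<omega>(1) by (auto simp: G_def Bad_def dev_def)
    ultimately show False using y(2) by linarith
  qed
  moreover have "disc ` G \<subseteq> ({..<k} \<rightarrow>\<^sub>E I)"
  proof
    fix d assume "d \<in> disc ` G"
    then obtain c where c: "c \<in> F" "d = disc c" by (auto simp: G_def)
    have "- (2 * B / \<epsilon>) \<le> 2 * c x / \<epsilon>" "2 * c x / \<epsilon> \<le> 2 * B / \<epsilon>" for x
      using F(2)[OF c(1), of x] \<open>0 < \<epsilon>\<close> by (auto simp: field_simps abs_le_iff)
    then have "\<lfloor>2 * c x / \<epsilon>\<rfloor> \<in> I" for x
      unfolding I_def by (auto intro: floor_mono)
    then show "d \<in> {..<k} \<rightarrow>\<^sub>E I" by (auto simp: c disc_def)
  qed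
  ultimately have "card G \<le> card ({..<k} \<rightarrow>\<^sub>E I)"
    by (intro card_inj_on_le) (auto simp: I_def intro!: finite_PiE)
  also have "\<dots> = card I ^ k" by (simp add: card_PiE)
  finally have "real (card G) \<le> real (card I) ^ k" by (simp flip: of_nat_power)
  also have "\<dots> \<le> (4 * B / \<epsilon> + 3) ^ k"
  proof (rule power_mono)
    have "0 \<le> 2 * B / \<epsilon>" using \<open>0 < B\<close> \<open>0 < \<epsilon>\<close> by simp
    then show "real (card I) \<le> 4 * B / \<epsilon> + 3" unfolding I_def by (simp; linarith)
  qed simp
  finally have "real (card G) \<le> (4 * B / \<epsilon> + 3) ^ k" .
  moreover have "real (card F) \<le> 2 * real (card G)" using G_large by simp
  ultimately show ?thesis by linarith
qed

text \<open>The packing bound makes a packing of maximal cardinality exist. By maximality every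
  \<open>c\<close> fails to be separated from some member, which serves as its label; two
  coefficients with the same label are then within \<open>2 * \<epsilon>\<close> by the triangle
  inequality. Cells are encoded as the fibres of \<open>lab\<close>.\<close>

lemma feature_cover:
  fixes K Z :: "('a \<Rightarrow> real) set"
  assumes "prob_space Q" "finite Z" "0 < \<epsilon>" "0 < B" "0 < k"
    and K: "\<And>c. c \<in> K \<Longrightarrow> c \<in> borel_measurable Q" "\<And>c \<theta>. c \<in> K \<Longrightarrow> \<bar>c \<theta>\<bar> \<le> B"
    and Z: "\<And>y. y \<in> Z \<Longrightarrow> y \<in> borel_measurable Q" "\<And>y \<theta>. y \<in> Z \<Longrightarrow> \<bar>y \<theta>\<bar> \<le> 1"
    and k: "4 * card Z * exp (- (k * \<epsilon>\<^sup>2 / (32 * B\<^sup>2))) \<le> 1"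
  obtains lab :: "('a \<Rightarrow> real) \<Rightarrow> ('a \<Rightarrow> real)"
  where "finite (lab ` K)" "card (lab ` K) \<le> 2 * (4 * B / \<epsilon> + 3) ^ k"
    and "\<And>c c'. c \<in> K \<Longrightarrow> c' \<in> K \<Longrightarrow> lab c = lab c' \<Longrightarrow> \<not> feature_sep Q Z (2 * \<epsilon>) c c'"
proof -
  define packing where
    "packing F \<longleftrightarrow> finite F \<and> F \<subseteq> K \<and> (\<forall>c\<in>F. \<forall>c'\<in>F. c \<noteq> c' \<longrightarrow> feature_sep Q Z \<epsilon> c c')" for F
  have bound: "card F \<le> 2 * (4 * B / \<epsilon> + 3) ^ k" if "packing F" for F
    using that K Z k assms(1-5) unfolding packing_def
    by (intro feature_packing_bound[where Q = Q and Z = Z]) auto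
  have "packing {}" by (simp add: packing_def)
  moreover have "card F \<le> nat \<lfloor>2 * (4 * B / \<epsilon> + 3) ^ k\<rfloor>" if "packing F" for F
    using bound[OF that] by (simp add: le_nat_floor)
  ultimately obtain F where F: "packing F" and max: "\<And>F'. packing F' \<Longrightarrow> card F' \<le> card F"
    using ex_has_greatest_nat[of packing "{}" card "nat \<lfloor>2 * (4 * B / \<epsilon> + 3) ^ k\<rfloor> + 1"]
    by (metis le_imp_less_Suc Suc_eq_plus1)
  have sym: "feature_sep Q Z \<epsilon> c c' \<longleftrightarrow> feature_sep Q Z \<epsilon> c' c" for c c'
    by (simp add: feature_sep_def abs_minus_commute)
  have near: "\<exists>c'\<in>F. \<not> feature_sep Q Z \<epsilon> c c'" if "c \<in> K" for c
  proof (rule ccontr)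
    assume far: "\<not> ?thesis"
    moreover have "\<not> feature_sep Q Z \<epsilon> c c"
      using \<open>0 < \<epsilon>\<close> by (simp add: feature_sep_def)
    ultimately have "c \<notin> F" by blast
    moreover have "packing (insert c F)"
      using F far that sym by (auto simp: packing_def)
    ultimately show False
      using max[of "insert c F"] F by (simp add: packing_def)
  qed
  define lab where "lab c = (SOME c'. c' \<in> F \<and> \<not> feature_sep Q Z \<epsilon> c c')" for c
  have lab: "lab c \<in> F" "\<not> feature_sep Q Z \<epsilon> c (lab c)" if "c \<in> K" for c
    using someI_ex[of "\<lambda>c'. c' \<in> F \<and> \<not> feature_sep Q Z \<epsilon> c c'"] near[OF that]
    unfolding lab_def by blast+
  show thesis
  proof
    have "finite F" using F by (simp add: packing_def)
    then show "finite (lab ` K)" using lab(1) by (meson finite_subset image_subsetI)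
    have "card (lab ` K) \<le> card F" using lab(1) \<open>finite F\<close> by (intro card_mono) auto
    then show "card (lab ` K) \<le> 2 * (4 * B / \<epsilon> + 3) ^ k" using bound[OF F] by linarith
  next
    fix c c' assume cc': "c \<in> K" "c' \<in> K" "lab c = lab c'"
    have "\<bar>(\<integral>\<theta>. c \<theta> * y \<theta> \<partial>Q) - (\<integral>\<theta>. lab c \<theta> * y \<theta> \<partial>Q)\<bar> \<le> \<epsilon>"
      "\<bar>(\<integral>\<theta>. c' \<theta> * y \<theta> \<partial>Q) - (\<integral>\<theta>. lab c \<theta> * y \<theta> \<partial>Q)\<bar> \<le> \<epsilon>" if "y \<in> Z" for y
      using lab(2)[OF cc'(1)] lab(2)[OF cc'(2)] that unfolding feature_sep_def cc'(3)
      by (auto simp: not_less)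
    then show "\<not> feature_sep Q Z (2 * \<epsilon>) c c'"
      unfolding feature_sep_def by (auto simp: not_less) (smt (verit))
  qed
qed

subsection \<open>Generalization from finitely many cells\<close>

text \<open>All \<open>n\<close> points miss a set of measure at least \<open>r\<close> with
  probability at most \<open>(1 - r) ^ n\<close>, which is at most
  \<open>exp (- r * n)\<close>.\<close>

lemma label_union_bound:
  fixes D :: "'x measure" and J :: "'l set" and A :: "'l \<Rightarrow> 'x set"
  assumes "prob_space D" "finite J" and A: "\<And>j. j \<in> J \<Longrightarrow> A j \<in> sets D"
    and large: "\<And>j. j \<in> J \<Longrightarrow> r \<le> measure D (A j)" and r: "card J * exp (- r * n) \<le> \<delta>"
  obtains E where "E \<in> sets (\<Pi>\<^sub>M i\<in>{..<n::nat}. D)" "1 - \<delta> \<le> measure (\<Pi>\<^sub>M i\<in>{..<n}. D) E"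
    "\<And>\<xi> j. \<xi> \<in> E \<Longrightarrow> j \<in> J \<Longrightarrow> \<exists>i<n. \<xi> i \<in> A j"
proof -
  define P where "P = (\<Pi>\<^sub>M i\<in>{..<n}. D)"
  interpret D: prob_space D by fact
  interpret P: prob_space P
    unfolding P_def by (intro prob_space_PiM assms(1))
  interpret fp: finite_product_prob_space "\<lambda>_. D" "{..<n}"
    by unfold_locales auto
  define N where "N j = (\<Pi>\<^sub>E i\<in>{..<n}. space D - A j)" for j
  have N: "N j \<in> sets P" if "j \<in> J" for j
    unfolding N_def P_def using A[OF that] by (intro sets_PiM_I_finite) auto
  have "P.prob (N j) \<le> exp (- r * n)" if "j \<in> J" for j
  proof -
    have "P.prob (N j) = (\<Prod>i<n. D.prob (space D - A j))"
      unfolding N_def P_def using A[OF that] by (intro fp.finite_measure_PiM_emb) auto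
    also have "\<dots> = (1 - D.prob (A j)) ^ n"
      using A[OF that] by (simp add: D.prob_compl)
    also have "\<dots> \<le> exp (- r) ^ n"
      using large[OF that] exp_ge_add_one_self[of "- r"] by (intro power_mono) auto
    also have "\<dots> = exp (- r * n)" by (simp flip: exp_of_nat_mult add: mult.commute)
    finally show ?thesis .
  qed
  then have "P.prob (\<Union>j\<in>J. N j) \<le> card J * exp (- r * n)"
    using P.finite_measure_subadditive_finite[of J N] N \<open>finite J\<close>
      sum_mono[of J "\<lambda>j. P.prob (N j)" "\<lambda>_. exp (- r * n)"] by fastforce
  with r have "P.prob (\<Union>j\<in>J. N j) \<le> \<delta>" by linarith
  moreover have UN: "(\<Union>j\<in>J. N j) \<in> sets P" using N \<open>finite J\<close> by auto
  ultimately have "1 - \<delta> \<le> P.prob (space P - (\<Union>j\<in>J. N j))" by (simp add: P.prob_compl)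
  moreover have "\<exists>i<n. \<xi> i \<in> A j" if "\<xi> \<in> space P - (\<Union>j\<in>J. N j)" "j \<in> J" for \<xi> j
    using that unfolding N_def P_def by (fastforce simp: space_PiM PiE_iff)
  ultimately show thesis
    using that[of "space P - (\<Union>j\<in>J. N j)"] UN unfolding P_def by (metis sets.compl_sets)
qed

text \<open>
  \<open>Pos v\<close> need not be measurable. A non-measurable set has \<^const>\<open>measure\<close> zero, so per label it
  suffices to have the sample hit one measurable set \<open>Pos v\<close> of measure at least \<open>r\<close>.
\<close>

lemma label_generalization:
  fixes D :: "'x measure" and lab :: "'v \<Rightarrow> 'l" and Pos Bad :: "'v \<Rightarrow> 'x set"
  assumes "prob_space D" "finite (lab ` \<V>)" "0 < r" "card (lab ` \<V>) * exp (- r * n) \<le> \<delta>"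
    and sub: "\<And>v v'. v \<in> \<V> \<Longrightarrow> v' \<in> \<V> \<Longrightarrow> lab v = lab v' \<Longrightarrow> Pos v \<subseteq> Bad v'"
  obtains E where "E \<in> sets (\<Pi>\<^sub>M i\<in>{..<n::nat}. D)" "1 - \<delta> \<le> measure (\<Pi>\<^sub>M i\<in>{..<n}. D) E"
    "\<And>\<xi> v. \<xi> \<in> E \<Longrightarrow> v \<in> \<V> \<Longrightarrow> (\<And>i. i < n \<Longrightarrow> \<xi> i \<notin> Bad v) \<Longrightarrow> measure D (Pos v) < r"
proof -
  define heavy where "heavy v \<longleftrightarrow> v \<in> \<V> \<and> r \<le> measure D (Pos v)" for v
  define J where "J = lab ` {v. heavy v}"
  define rep where "rep j = (SOME v. heavy v \<and> lab v = j)" for j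
  have rep: "heavy (rep j)" "lab (rep j) = j" if "j \<in> J" for j
    using that someI_ex[of "\<lambda>v. heavy v \<and> lab v = j"] unfolding J_def rep_def by blast+
  have J: "J \<subseteq> lab ` \<V>" by (auto simp: J_def heavy_def)
  have "finite J" by (rule finite_subset[OF J assms(2)])
  have "card J \<le> card (lab ` \<V>)" by (rule card_mono[OF assms(2) J])
  then have card: "card J * exp (- r * n) \<le> \<delta>"
    using assms(4) by (elim order_trans[rotated]) (simp add: mult_right_mono)
  obtain E where E: "E \<in> sets (\<Pi>\<^sub>M i\<in>{..<n}. D)" "1 - \<delta> \<le> measure (\<Pi>\<^sub>M i\<in>{..<n}. D) E"
      and hit: "\<And>\<xi> j. \<xi> \<in> E \<Longrightarrow> j \<in> J \<Longrightarrow> \<exists>i<n. \<xi> i \<in> Pos (rep j)"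
  proof (rule label_union_bound[OF assms(1) \<open>finite J\<close> _ _ card])
    fix j assume "j \<in> J"
    show "r \<le> measure D (Pos (rep j))" using rep(1)[OF \<open>j \<in> J\<close>] by (simp add: heavy_def)
    with \<open>0 < r\<close> show "Pos (rep j) \<in> sets D" by (metis measure_notin_sets not_less)
  qed blast
  show thesis
  proof (rule that[OF E], rule ccontr)
    fix \<xi> v assume \<xi>: "\<xi> \<in> E" and v: "v \<in> \<V>" and avoid: "\<And>i. i < n \<Longrightarrow> \<xi> i \<notin> Bad v"
      and "\<not> measure D (Pos v) < r"
    then have "lab v \<in> J" by (auto simp: J_def heavy_def)
    \<comment> \<open>A sample point in \<open>Pos (rep (lab v))\<close> lies in
      \<open>Bad v\<close> by \<open>sub\<close>, so one representative per label settles all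
      members of the cell.\<close>
    with hit[OF \<xi>] rep sub v avoid show False by (metis heavy_def subsetD)
  qed
qed

subsection \<open>Ridge features\<close>

lemma norm_vec_nonneg [simp]: "0 \<le> norm_vec p x"
  by (simp add: norm_vec_def)

lemma abs_le_norm_vec: "i < p \<Longrightarrow> \<bar>x i\<bar> \<le> norm_vec p x"
  unfolding norm_vec_def using member_le_L2_set[of "{..<p}" i "\<lambda>i. \<bar>x i\<bar>"]
  by (simp add: L2_set_def)

lemma norm_vec_triangle: "norm_vec p (\<lambda>i. x i + y i) \<le> norm_vec p x + norm_vec p y"
  unfolding norm_vec_def by (rule L2_set_triangle_ineq)

lemma norm_vec_scale: "norm_vec p (\<lambda>i. r * x i) = \<bar>r\<bar> * norm_vec p x"
  unfolding norm_vec_def L2_set_def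
  by (simp add: power_mult_distrib real_sqrt_mult flip: sum_distrib_left)

lemma norm_vec_diff_le: "norm_vec p (\<lambda>i. x i - y i) \<le> norm_vec p x + norm_vec p y"
  using norm_vec_triangle[of p x "\<lambda>i. - 1 * y i"] by (simp only: norm_vec_scale) simp

text \<open>Coordinates from \<open>p\<close> on are ignored. This is why sums, differences and grid
  points below may be functions that are not extensional.\<close>

lemma norm_vec_cong: "(\<And>i. i < p \<Longrightarrow> x i = y i) \<Longrightarrow> norm_vec p x = norm_vec p y"
  unfolding norm_vec_def by (rule L2_set_cong) auto

lemma inner_vec_self: "inner_vec p x x = (norm_vec p x)\<^sup>2"
  by (simp add: inner_vec_def norm_vec_def L2_set_def sum_nonneg power2_eq_square)

lemma abs_inner_vec_le: "\<bar>inner_vec p x y\<bar> \<le> norm_vec p x * norm_vec p y"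
proof -
  have "\<bar>inner_vec p x y\<bar> \<le> (\<Sum>i<p. \<bar>x i\<bar> * \<bar>y i\<bar>)"
    unfolding inner_vec_def by (rule order_trans[OF sum_abs]) (simp add: abs_mult)
  also have "\<dots> \<le> norm_vec p x * norm_vec p y"
    unfolding norm_vec_def by (rule L2_set_mult_ineq)
  finally show ?thesis .
qed

lemma inner_vec_scale: "inner_vec p (\<lambda>i. r * x i) y = r * inner_vec p x y"
  by (simp add: inner_vec_def sum_distrib_left mult.assoc)

lemma inner_vec_add: "inner_vec p (\<lambda>i. x i + y i) z = inner_vec p x z + inner_vec p y z"
  by (simp add: inner_vec_def sum.distrib distrib_right)

lemma inner_vec_diff: "inner_vec p (\<lambda>i. x i - y i) z = inner_vec p x z - inner_vec p y z"
  by (simp add: inner_vec_def sum_subtractf left_diff_distrib)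

lemma norm_pair_ge: "norm_vec p w \<le> norm_pair p (w, b)"
  by (simp add: norm_pair_def real_le_rsqrt)

lemma norm_pair_le: "norm_pair p (w, b) \<le> norm_vec p w + \<bar>b\<bar>"
  unfolding norm_pair_def using sqrt_sum_squares_le_sum_abs[of "norm_vec p w" b] by simp

section \<open>First-order estimates for Lipschitz functions of one variable\<close>

lemma lipschitz_deriv_taylor:
  fixes \<phi> :: "real \<Rightarrow> real"
  assumes diff: "\<And>s. \<phi> differentiable at s" and lip: "L-lipschitz_on UNIV (deriv \<phi>)"
  shows "\<bar>\<phi> (z + s) - \<phi> z - s * deriv \<phi> z\<bar> \<le> L * s\<^sup>2"
proof -
  have D: "(\<phi> has_real_derivative deriv \<phi> t) (at t)" for t
    using diff[of t] by (simp add: DERIV_deriv_iff_real_differentiable)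
  have "0 \<le> L" using lip by (rule lipschitz_on_nonneg)
  have "\<exists>t. \<bar>t - z\<bar> \<le> \<bar>s\<bar> \<and> \<phi> (z + s) - \<phi> z = s * deriv \<phi> t"
  proof (cases s "0 :: real" rule: linorder_cases)
    case less
    then obtain t where "z + s < t" "t < z" "\<phi> z - \<phi> (z + s) = (z - (z + s)) * deriv \<phi> t"
      using MVT2[of "z + s" z \<phi> "deriv \<phi>"] D by auto
    then show ?thesis using less by (intro exI[of _ t]) auto
  next
    case greater
    then obtain t where "z < t" "t < z + s" "\<phi> (z + s) - \<phi> z = (z + s - z) * deriv \<phi> t"
      using MVT2[of z "z + s" \<phi> "deriv \<phi>"] D by auto
    then show ?thesis using greater by (intro exI[of _ t]) auto
  qed auto
  then obtain t where t: "\<bar>t - z\<bar> \<le> \<bar>s\<bar>" "\<phi> (z + s) - \<phi> z = s * deriv \<phi> t" by blast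
  have "\<bar>deriv \<phi> t - deriv \<phi> z\<bar> \<le> L * \<bar>t - z\<bar>"
    using lipschitz_onD[OF lip, of t z] by (simp add: dist_real_def)
  also have "\<dots> \<le> L * \<bar>s\<bar>" using t(1) \<open>0 \<le> L\<close> by (rule mult_left_mono)
  finally have "\<bar>s\<bar> * \<bar>deriv \<phi> t - deriv \<phi> z\<bar> \<le> \<bar>s\<bar> * (L * \<bar>s\<bar>)" by (rule mult_left_mono) simp
  also have "\<dots> = L * s\<^sup>2" by (simp add: power2_eq_square abs_mult_self_eq)
  finally show ?thesis by (simp add: t(2) right_diff_distrib flip: abs_mult)
qed

lemma lipschitz_abs_deriv_le:
  fixes \<phi> :: "real \<Rightarrow> real"
  assumes diff: "\<phi> differentiable at z" and lip: "L-lipschitz_on UNIV \<phi>"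
  shows "\<bar>deriv \<phi> z\<bar> \<le> L"
proof -
  have "((\<lambda>s. (\<phi> (z + s) - \<phi> z) / s) \<longlongrightarrow> deriv \<phi> z) (at 0)"
    using diff DERIV_deriv_iff_real_differentiable DERIV_def by blast
  then have "((\<lambda>s. \<bar>(\<phi> (z + s) - \<phi> z) / s\<bar>) \<longlongrightarrow> \<bar>deriv \<phi> z\<bar>) (at 0)"
    by (rule tendsto_rabs)
  moreover have "\<forall>\<^sub>F s in at 0. \<bar>(\<phi> (z + s) - \<phi> z) / s\<bar> \<le> L"
    unfolding eventually_at_filter
  proof (intro always_eventually allI impI)
    fix s :: real assume "s \<noteq> 0"
    then show "\<bar>(\<phi> (z + s) - \<phi> z) / s\<bar> \<le> L"
      using lipschitz_onD[OF lip, of "z + s" z] by (simp add: dist_real_def abs_divide divide_le_eq)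
  qed
  ultimately show ?thesis by (rule tendsto_upperbound) simp
qed

text \<open>\<open>Q\<close> will be the law of the parameter with density \<nu>. The norm bound is
  required on \<Theta> only; the coefficients below vanish elsewhere, which makes all bounds on
  integrands hold pointwise.\<close>

locale ridge_features = prob_space Q
  for Q :: "(vec \<times> real) measure" +
  fixes p :: nat and \<Theta> :: "(vec \<times> real) set" and \<phi> :: "real \<Rightarrow> real" and B\<theta> L L' :: real
  assumes coord_measurable [measurable]: "i < p \<Longrightarrow> (\<lambda>\<theta>. fst \<theta> i) \<in> borel_measurable Q"
    and snd_measurable [measurable]: "snd \<in> borel_measurable Q"
    and norm_le: "\<theta> \<in> \<Theta> \<Longrightarrow> norm_pair p \<theta> \<le> B\<theta>"
    and B\<theta>_nonneg: "0 \<le> B\<theta>"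
    and \<phi>_le: "\<bar>\<phi> s\<bar> \<le> 1" and \<phi>_lip: "L-lipschitz_on UNIV \<phi>"
    and \<phi>_diff: "\<phi> differentiable at s" and \<phi>'_lip: "L'-lipschitz_on UNIV (deriv \<phi>)"
begin

definition arg :: "vec \<Rightarrow> vec \<times> real \<Rightarrow> real" where
  "arg x \<theta> = inner_vec p x (fst \<theta>) + snd \<theta>"

definition F :: "(vec \<times> real \<Rightarrow> real) \<Rightarrow> vec \<Rightarrow> real" where
  "F c x = expectation (\<lambda>\<theta>. c \<theta> * \<phi> (arg x \<theta>))"

text \<open>The gradient of \<open>F c\<close> as differentiation under the integral sign would give
  it; \<open>grad_F\<close> identifies the two on the first \<open>p\<close> coordinates.\<close>

definition G :: "(vec \<times> real \<Rightarrow> real) \<Rightarrow> vec \<Rightarrow> vec" where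
  "G c x i = expectation (\<lambda>\<theta>. c \<theta> * (deriv \<phi> (arg x \<theta>) * fst \<theta> i))"

text \<open>The bound holds everywhere rather than almost everywhere, since the packing argument
  evaluates coefficients at individual drawn parameters.\<close>

definition coeffs :: "real \<Rightarrow> (vec \<times> real \<Rightarrow> real) set" where
  "coeffs B = {c. c \<in> borel_measurable Q \<and> (\<forall>\<theta>. \<bar>c \<theta>\<bar> \<le> B) \<and> (\<forall>\<theta>. \<theta> \<notin> \<Theta> \<longrightarrow> c \<theta> = 0)}"

lemma L_nonneg: "0 \<le> L" and L'_nonneg: "0 \<le> L'"
  using \<phi>_lip \<phi>'_lip by (auto intro: lipschitz_on_nonneg)

lemma coeffs_nonneg: "c \<in> coeffs B \<Longrightarrow> 0 \<le> B"
  unfolding coeffs_def by (smt (verit) mem_Collect_eq)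

lemma coeffs_diff: "c \<in> coeffs B \<Longrightarrow> c' \<in> coeffs B \<Longrightarrow> (\<lambda>\<theta>. c \<theta> - c' \<theta>) \<in> coeffs (2 * B)"
  unfolding coeffs_def by (auto simp: abs_le_iff) (smt (verit))+

lemma arg_measurable [measurable]: "arg x \<in> borel_measurable Q"
  unfolding arg_def inner_vec_def by (intro borel_measurable_add borel_measurable_sum) auto

lemma \<phi>_measurable [measurable]: "\<phi> \<in> borel_measurable borel"
  and deriv_\<phi>_measurable [measurable]: "deriv \<phi> \<in> borel_measurable borel"
  using \<phi>_lip \<phi>'_lip
  by (auto intro!: borel_measurable_continuous_onI lipschitz_on_continuous_on)

lemma weight_norm_le: "\<theta> \<in> \<Theta> \<Longrightarrow> norm_vec p (fst \<theta>) \<le> B\<theta>"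
  using norm_le[of \<theta>] norm_pair_ge[of p "fst \<theta>" "snd \<theta>"] by simp

lemma coeffs_mult_le:
  assumes "c \<in> coeffs B" "\<And>\<theta>. \<theta> \<in> \<Theta> \<Longrightarrow> \<bar>y \<theta>\<bar> \<le> M" "0 \<le> M"
  shows "\<bar>c \<theta> * y \<theta>\<bar> \<le> B * M"
proof (cases "\<theta> \<in> \<Theta>")
  case True
  then have "\<bar>c \<theta>\<bar> * \<bar>y \<theta>\<bar> \<le> B * M"
    using assms coeffs_nonneg[OF assms(1)] by (intro mult_mono) (simp_all add: coeffs_def del: split_paired_All)
  then show ?thesis by (simp add: abs_mult)
next
  case False
  then show ?thesis using assms coeffs_nonneg[OF assms(1)] by (simp add: coeffs_def del: split_paired_All)
qed

lemma
  assumes c: "c \<in> coeffs B" and y: "y \<in> borel_measurable Q"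
    and M: "\<And>\<theta>. \<theta> \<in> \<Theta> \<Longrightarrow> \<bar>y \<theta>\<bar> \<le> M" "0 \<le> M"
  shows coeffs_integrable: "integrable Q (\<lambda>\<theta>. c \<theta> * y \<theta>)"
    and coeffs_expectation_le: "\<bar>expectation (\<lambda>\<theta>. c \<theta> * y \<theta>)\<bar> \<le> B * M"
proof -
  have [measurable]: "c \<in> borel_measurable Q" using c by (simp add: coeffs_def)
  have le: "\<bar>c \<theta> * y \<theta>\<bar> \<le> B * M" for \<theta>
    by (rule coeffs_mult_le[OF c M])
  show int: "integrable Q (\<lambda>\<theta>. c \<theta> * y \<theta>)"
    by (rule integrable_const_bound[of _ "B * M"]) (use le y in \<open>auto simp: abs_mult\<close>)
  have "\<bar>expectation (\<lambda>\<theta>. c \<theta> * y \<theta>)\<bar> \<le> expectation (\<lambda>\<theta>. \<bar>c \<theta> * y \<theta>\<bar>)"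
    by (rule integral_abs_bound)
  also have "\<dots> \<le> expectation (\<lambda>_. B * M)"
    by (rule integral_mono) (use int le in auto)
  finally show "\<bar>expectation (\<lambda>\<theta>. c \<theta> * y \<theta>)\<bar> \<le> B * M" by (simp add: prob_space)
qed

lemma \<phi>_arg_measurable [measurable]: "(\<lambda>\<theta>. \<phi> (arg x \<theta>)) \<in> borel_measurable Q"
  by measurable

lemma F_integrable: "c \<in> coeffs B \<Longrightarrow> integrable Q (\<lambda>\<theta>. c \<theta> * \<phi> (arg x \<theta>))"
  by (rule coeffs_integrable[where M = 1]) (auto simp: \<phi>_le)

lemma abs_F_le: "c \<in> coeffs B \<Longrightarrow> \<bar>F c x\<bar> \<le> B"
  unfolding F_def using coeffs_expectation_le[of c B "\<lambda>\<theta>. \<phi> (arg x \<theta>)" 1] by (simp add: \<phi>_le)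

lemma abs_deriv_weight_le:
  assumes "i < p" "\<theta> \<in> \<Theta>"
  shows "\<bar>deriv \<phi> (arg x \<theta>) * fst \<theta> i\<bar> \<le> L * B\<theta>"
proof -
  have "\<bar>deriv \<phi> (arg x \<theta>)\<bar> * \<bar>fst \<theta> i\<bar> \<le> L * B\<theta>"
    using lipschitz_abs_deriv_le[OF \<phi>_diff \<phi>_lip] weight_norm_le[OF assms(2)]
      abs_le_norm_vec[OF assms(1), of "fst \<theta>"] L_nonneg by (intro mult_mono) auto
  then show ?thesis by (simp add: abs_mult)
qed

lemma deriv_weight_measurable [measurable]:
  "i < p \<Longrightarrow> (\<lambda>\<theta>. deriv \<phi> (arg x \<theta>) * fst \<theta> i) \<in> borel_measurable Q"
  by measurable

lemma G_integrable: "c \<in> coeffs B \<Longrightarrow> i < p \<Longrightarrow> integrable Q (\<lambda>\<theta>. c \<theta> * (deriv \<phi> (arg x \<theta>) * fst \<theta> i))"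
  by (rule coeffs_integrable[where M = "L * B\<theta>"])
     (auto simp: abs_deriv_weight_le L_nonneg B\<theta>_nonneg)

lemma F_diff:
  assumes "c \<in> coeffs B" "c' \<in> coeffs B"
  shows "F (\<lambda>\<theta>. c \<theta> - c' \<theta>) x = F c x - F c' x"
  unfolding F_def using F_integrable assms by (simp add: left_diff_distrib)

lemma G_diff:
  assumes "c \<in> coeffs B" "c' \<in> coeffs B" "i < p"
  shows "G (\<lambda>\<theta>. c \<theta> - c' \<theta>) x i = G c x i - G c' x i"
  unfolding G_def using G_integrable assms by (simp add: left_diff_distrib)

lemma F_lipschitz:
  assumes c: "c \<in> coeffs B"
  shows "\<bar>F c x - F c x'\<bar> \<le> B * (L * B\<theta>) * norm_vec p (\<lambda>i. x i - x' i)"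
proof -
  have "F c x - F c x' = expectation (\<lambda>\<theta>. c \<theta> * (\<phi> (arg x \<theta>) - \<phi> (arg x' \<theta>)))"
    unfolding F_def using F_integrable[OF c] by (simp add: right_diff_distrib)
  also have "\<bar>\<dots>\<bar> \<le> B * (L * B\<theta> * norm_vec p (\<lambda>i. x i - x' i))"
  proof (rule coeffs_expectation_le[OF c])
    fix \<theta> assume "\<theta> \<in> \<Theta>"
    have "\<bar>\<phi> (arg x \<theta>) - \<phi> (arg x' \<theta>)\<bar> \<le> L * \<bar>inner_vec p (\<lambda>i. x i - x' i) (fst \<theta>)\<bar>"
      using lipschitz_onD[OF \<phi>_lip, of "arg x \<theta>" "arg x' \<theta>"]
      by (simp add: dist_real_def arg_def inner_vec_diff)
    also have "\<dots> \<le> L * (norm_vec p (\<lambda>i. x i - x' i) * B\<theta>)"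
      using abs_inner_vec_le[of p "\<lambda>i. x i - x' i" "fst \<theta>"] weight_norm_le[OF \<open>\<theta> \<in> \<Theta>\<close>] L_nonneg
      by (intro mult_left_mono order_trans[OF abs_inner_vec_le]) auto
    finally show "\<bar>\<phi> (arg x \<theta>) - \<phi> (arg x' \<theta>)\<bar> \<le> L * B\<theta> * norm_vec p (\<lambda>i. x i - x' i)"
      by (simp add: mult_ac)
  qed (auto simp: L_nonneg B\<theta>_nonneg)
  finally show ?thesis by (simp add: mult.assoc)
qed

lemma inner_G:
  assumes c: "c \<in> coeffs B"
  shows "inner_vec p y (G c x) = expectation (\<lambda>\<theta>. c \<theta> * (deriv \<phi> (arg x \<theta>) * inner_vec p y (fst \<theta>)))"
proof -
  have "inner_vec p y (G c x)
      = (\<Sum>i<p. expectation (\<lambda>\<theta>. y i * (c \<theta> * (deriv \<phi> (arg x \<theta>) * fst \<theta> i))))"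
    by (simp add: inner_vec_def G_def)
  also have "\<dots> = expectation (\<lambda>\<theta>. \<Sum>i<p. y i * (c \<theta> * (deriv \<phi> (arg x \<theta>) * fst \<theta> i)))"
    using G_integrable[OF c] by (subst Bochner_Integration.integral_sum) auto
  also have "\<dots> = expectation (\<lambda>\<theta>. c \<theta> * (deriv \<phi> (arg x \<theta>) * inner_vec p y (fst \<theta>)))"
    by (simp add: inner_vec_def sum_distrib_left mult_ac)
  finally show ?thesis .
qed

lemma inner_weight_measurable [measurable]: "(\<lambda>\<theta>. inner_vec p y (fst \<theta>)) \<in> borel_measurable Q"
  unfolding inner_vec_def by (intro borel_measurable_sum) auto

text \<open>The one-variable remainder estimate is applied to each ridge and integrated against
  \<open>c\<close>. It serves both to differentiate under the integral and to recover gradients from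
  values.\<close>

lemma F_taylor:
  assumes c: "c \<in> coeffs B"
  shows "\<bar>F c (\<lambda>i. x i + y i) - F c x - inner_vec p y (G c x)\<bar> \<le> B * (L' * B\<theta>\<^sup>2) * (norm_vec p y)\<^sup>2"
proof -
  have int_d: "integrable Q (\<lambda>\<theta>. c \<theta> * (deriv \<phi> (arg x \<theta>) * inner_vec p y (fst \<theta>)))"
  proof (rule coeffs_integrable[OF c])
    fix \<theta> assume "\<theta> \<in> \<Theta>"
    have "\<bar>inner_vec p y (fst \<theta>)\<bar> \<le> norm_vec p y * B\<theta>"
      using weight_norm_le[OF \<open>\<theta> \<in> \<Theta>\<close>] by (intro order_trans[OF abs_inner_vec_le] mult_left_mono) auto
    then show "\<bar>deriv \<phi> (arg x \<theta>) * inner_vec p y (fst \<theta>)\<bar> \<le> L * (norm_vec p y * B\<theta>)"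
      unfolding abs_mult using lipschitz_abs_deriv_le[OF \<phi>_diff \<phi>_lip] L_nonneg by (intro mult_mono) auto
  qed (auto simp: L_nonneg B\<theta>_nonneg)
  have "F c (\<lambda>i. x i + y i) - F c x - inner_vec p y (G c x)
      = expectation (\<lambda>\<theta>. c \<theta> * (\<phi> (arg (\<lambda>i. x i + y i) \<theta>) - \<phi> (arg x \<theta>)
          - inner_vec p y (fst \<theta>) * deriv \<phi> (arg x \<theta>)))"
    unfolding inner_G[OF c] unfolding F_def using F_integrable[OF c] int_d
    by (simp add: right_diff_distrib mult.commute[of "inner_vec p y _"])
  also have "\<bar>\<dots>\<bar> \<le> B * (L' * (norm_vec p y * B\<theta>)\<^sup>2)"
  proof (rule coeffs_expectation_le[OF c])
    fix \<theta> assume "\<theta> \<in> \<Theta>"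
    have "\<bar>inner_vec p y (fst \<theta>)\<bar> \<le> norm_vec p y * B\<theta>"
      using weight_norm_le[OF \<open>\<theta> \<in> \<Theta>\<close>] by (intro order_trans[OF abs_inner_vec_le] mult_left_mono) auto
    then have "(inner_vec p y (fst \<theta>))\<^sup>2 \<le> (norm_vec p y * B\<theta>)\<^sup>2"
      by (metis abs_ge_zero power2_abs power_mono)
    then have "L' * (inner_vec p y (fst \<theta>))\<^sup>2 \<le> L' * (norm_vec p y * B\<theta>)\<^sup>2"
      using L'_nonneg by (rule mult_left_mono)
    moreover have "arg (\<lambda>i. x i + y i) \<theta> = arg x \<theta> + inner_vec p y (fst \<theta>)"
      by (simp add: arg_def inner_vec_add)
    ultimately show "\<bar>\<phi> (arg (\<lambda>i. x i + y i) \<theta>) - \<phi> (arg x \<theta>)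
          - inner_vec p y (fst \<theta>) * deriv \<phi> (arg x \<theta>)\<bar> \<le> L' * (norm_vec p y * B\<theta>)\<^sup>2"
      using lipschitz_deriv_taylor[OF \<phi>_diff \<phi>'_lip, of "arg x \<theta>" "inner_vec p y (fst \<theta>)"] by simp
  qed (auto simp: L'_nonneg)
  finally show ?thesis by (simp add: power_mult_distrib mult_ac)
qed

text \<open>Testing the gradient against itself reduces its norm to a single expectation, where
  Cauchy-Schwarz with \<open>w\<close> applies. Bounding the coordinates separately would cost a
  factor \<open>sqrt p\<close>.\<close>

lemma norm_G_le:
  assumes c: "c \<in> coeffs B"
  shows "norm_vec p (G c x) \<le> B * (L * B\<theta>)"
proof (cases "norm_vec p (G c x) = 0")
  case True
  then show ?thesis using coeffs_nonneg[OF c] L_nonneg B\<theta>_nonneg by simp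
next
  case False
  let ?g = "G c x"
  have "(norm_vec p ?g)\<^sup>2 \<le> \<bar>inner_vec p ?g ?g\<bar>" by (simp add: inner_vec_self)
  also have "\<dots> \<le> B * (L * (norm_vec p ?g * B\<theta>))"
    unfolding inner_G[OF c]
  proof (rule coeffs_expectation_le[OF c])
    fix \<theta> assume "\<theta> \<in> \<Theta>"
    have "\<bar>inner_vec p ?g (fst \<theta>)\<bar> \<le> norm_vec p ?g * B\<theta>"
      using weight_norm_le[OF \<open>\<theta> \<in> \<Theta>\<close>] by (intro order_trans[OF abs_inner_vec_le] mult_left_mono) auto
    then show "\<bar>deriv \<phi> (arg x \<theta>) * inner_vec p ?g (fst \<theta>)\<bar> \<le> L * (norm_vec p ?g * B\<theta>)"
      unfolding abs_mult using lipschitz_abs_deriv_le[OF \<phi>_diff \<phi>_lip] L_nonneg by (intro mult_mono) auto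
  qed (auto simp: L_nonneg B\<theta>_nonneg)
  finally have "norm_vec p ?g * norm_vec p ?g \<le> norm_vec p ?g * (B * (L * B\<theta>))"
    by (simp add: power2_eq_square mult_ac)
  moreover have "0 < norm_vec p ?g" using False norm_vec_nonneg[of p ?g] by linarith
  ultimately show ?thesis by (subst (asm) mult_le_cancel_left_pos)
qed

text \<open>By \<open>F_taylor\<close> along a coordinate direction, the difference quotient with
  step \<open>s\<close> is off by at most a constant times \<open>\<bar>s\<bar>\<close>.\<close>

lemma grad_F:
  assumes c: "c \<in> coeffs B"
  shows "grad p (F c) x = restrict (G c x) {..<p}"
proof
  fix i show "grad p (F c) x i = restrict (G c x) {..<p} i"
  proof (cases "i < p")
    case True
    define M where "M = B * (L' * B\<theta>\<^sup>2)"
    have "0 \<le> M" unfolding M_def using coeffs_nonneg[OF c] L'_nonneg by simp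
    have quot: "\<bar>(F c (x(i := x i + s)) - F c (x(i := x i))) / s - G c x i\<bar> \<le> M * \<bar>s\<bar>"
      if False: "s \<noteq> 0" for s
    proof -
      have "\<bar>F c (\<lambda>j. x j + (if j = i then s else 0)) - F c x
            - inner_vec p (\<lambda>j. if j = i then s else 0) (G c x)\<bar>
          \<le> M * (norm_vec p (\<lambda>j. if j = i then s else 0))\<^sup>2"
        unfolding M_def by (rule F_taylor[OF c])
      moreover have "(\<lambda>j. x j + (if j = i then s else 0)) = x(i := x i + s)" by auto
      moreover have "inner_vec p (\<lambda>j. if j = i then s else 0) (G c x) = s * G c x i"
        using True by (simp add: inner_vec_def if_distrib[of "\<lambda>t. t * _"] cong: if_cong)
      moreover have "(norm_vec p (\<lambda>j. if j = i then s else 0))\<^sup>2 = s * s"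
        using True by (simp add: inner_vec_def if_distrib[of "\<lambda>t. t * _"] flip: inner_vec_self cong: if_cong)
      ultimately have "\<bar>F c (x(i := x i + s)) - F c x - s * G c x i\<bar> \<le> M * (s * s)" by simp
      then have "\<bar>F c (x(i := x i + s)) - F c x - s * G c x i\<bar> / \<bar>s\<bar> \<le> M * \<bar>s\<bar>"
        using False by (subst pos_divide_le_eq) (auto simp: mult.assoc)
      then show ?thesis using False by (simp add: abs_divide[symmetric] diff_divide_distrib)
    qed
    have "((\<lambda>s. (F c (x(i := x i + s)) - F c (x(i := x i))) / s - G c x i) \<longlongrightarrow> 0) (at 0)"
    proof (rule Lim_null_comparison)
      show "\<forall>\<^sub>F s in at 0. norm ((F c (x(i := x i + s)) - F c (x(i := x i))) / s - G c x i) \<le> M * \<bar>s\<bar>"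
        using quot by (simp add: eventually_at_filter)
      show "((\<lambda>s. M * \<bar>s\<bar>) \<longlongrightarrow> 0) (at 0)" by (auto intro!: tendsto_eq_intros)
    qed
    then have "((\<lambda>s. F c (x(i := s))) has_real_derivative G c x i) (at (x i))"
      by (simp add: DERIV_def LIM_zero_iff)
    then show ?thesis using True by (simp add: grad_def DERIV_imp_deriv)
  qed (simp add: grad_def)
qed

text \<open>A step of length \<open>r\<close> along the gradient changes \<open>F c\<close> by
  \<open>r\<close> times the norm of the gradient, up to the Taylor remainder, yet by at most
  \<open>2 * e\<close>. Dividing by \<open>r\<close> gives the bound; \<open>r\<close> is left free
  to balance the two terms.\<close>

lemma interpolation_bound:
  assumes c: "c \<in> coeffs B" and "0 < r"
    and sup: "\<And>y. norm_vec p (\<lambda>i. y i - x i) \<le> r \<Longrightarrow> \<bar>F c y\<bar> \<le> e"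
  shows "norm_vec p (G c x) \<le> 2 * e / r + B * (L' * B\<theta>\<^sup>2) * r"
proof (cases "norm_vec p (G c x) = 0")
  case True
  have "0 \<le> e" using sup[of x] \<open>0 < r\<close> by (simp add: norm_vec_def L2_set_def)
  then show ?thesis using True coeffs_nonneg[OF c] L'_nonneg \<open>0 < r\<close> by simp
next
  case False
  define g where "g = norm_vec p (G c x)"
  have "0 < g" using False norm_vec_nonneg[of p "G c x"] unfolding g_def by linarith
  define y where "y = (\<lambda>i. r / g * G c x i)"
  have y: "norm_vec p y = r"
    unfolding y_def norm_vec_scale using \<open>0 < g\<close> \<open>0 < r\<close> by (simp add: g_def)
  have "inner_vec p y (G c x) = r * g"
    unfolding y_def inner_vec_scale inner_vec_self using \<open>0 < g\<close> by (simp add: g_def power2_eq_square)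
  moreover have "\<bar>F c (\<lambda>i. x i + y i)\<bar> \<le> e" "\<bar>F c x\<bar> \<le> e"
    by (rule sup; use y \<open>0 < r\<close> in \<open>simp add: norm_vec_def L2_set_def\<close>)+
  moreover have "\<bar>F c (\<lambda>i. x i + y i) - F c x - inner_vec p y (G c x)\<bar> \<le> B * (L' * B\<theta>\<^sup>2) * r\<^sup>2"
    using F_taylor[OF c, of x y] by (simp add: y)
  ultimately have "r * g \<le> 2 * e + B * (L' * B\<theta>\<^sup>2) * r\<^sup>2" by linarith
  then have "g \<le> (2 * e + B * (L' * B\<theta>\<^sup>2) * r\<^sup>2) / r"
    using \<open>0 < r\<close> by (simp add: pos_le_divide_eq mult.commute)
  also have "\<dots> = 2 * e / r + B * (L' * B\<theta>\<^sup>2) * r"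
    using \<open>0 < r\<close> by (simp add: add_divide_distrib power2_eq_square)
  finally show ?thesis by (simp add: g_def)
qed

end

subsection \<open>Covering the class of certificates\<close>

lemma grid_net:
  fixes R d :: real
  assumes "0 < p" "0 \<le> R" "0 < d"
  obtains N :: "vec set" where "finite N" "card N \<le> (2 * R * sqrt p / d + 2) ^ p"
    "\<And>x. norm_vec p x \<le> R \<Longrightarrow> \<exists>y\<in>N. norm_vec p (\<lambda>i. x i - y i) \<le> d"
proof -
  \<comment> \<open>Rounding each of the \<open>p\<close> coordinates by at most \<open>s\<close>
    moves a point by at most \<open>sqrt p * s = d\<close>.\<close>
  define s where "s = d / sqrt p"
  have "0 < s" using assms by (simp add: s_def)
  define I where "I = {\<lfloor>- (R / s)\<rfloor>..\<lfloor>R / s\<rfloor>}"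
  define pt :: "(nat \<Rightarrow> int) \<Rightarrow> vec" where "pt z = (\<lambda>i. s * z i)" for z
  define N where "N = pt ` ({..<p} \<rightarrow>\<^sub>E I)"
  have fin: "finite ({..<p} \<rightarrow>\<^sub>E I)" by (auto simp: I_def intro!: finite_PiE)
  show thesis
  proof
    show "finite N" unfolding N_def using fin by simp
    have "0 \<le> R / s" using \<open>0 \<le> R\<close> \<open>0 < s\<close> by simp
    then have "real (card I) \<le> 2 * (R / s) + 2" unfolding I_def by (simp; linarith)
    also have "\<dots> = 2 * R * sqrt p / d + 2" by (simp add: s_def)
    finally have "real (card I) ^ p \<le> (2 * R * sqrt p / d + 2) ^ p" by (intro power_mono) auto
    moreover have "card N \<le> card I ^ p"
      unfolding N_def using card_image_le[OF fin, of pt] by (simp add: card_PiE)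
    ultimately show "card N \<le> (2 * R * sqrt p / d + 2) ^ p"
      by (smt (verit) of_nat_le_iff of_nat_power)
  next
    fix x assume x: "norm_vec p x \<le> R"
    define z where "z = (\<lambda>i\<in>{..<p}. \<lfloor>x i / s\<rfloor>)"
    have "\<lfloor>x i / s\<rfloor> \<in> I" if "i < p" for i
    proof -
      have "\<bar>x i\<bar> \<le> R" using abs_le_norm_vec[OF that, of x] x by linarith
      then have "- (R / s) \<le> x i / s" "x i / s \<le> R / s"
        using \<open>0 < s\<close> by (auto simp: abs_le_iff field_simps)
      then show ?thesis unfolding I_def by (auto intro: floor_mono)
    qed
    then have "pt z \<in> N" unfolding N_def z_def by (intro imageI PiE_I) auto
    moreover have "norm_vec p (\<lambda>i. x i - pt z i) \<le> d"
    proof -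
      have "(x i - pt z i)\<^sup>2 \<le> s\<^sup>2" if "i < p" for i
      proof -
        have "x i - pt z i = s * (x i / s - \<lfloor>x i / s\<rfloor>)"
          using that \<open>0 < s\<close> by (simp add: pt_def z_def right_diff_distrib)
        moreover have "\<bar>x i / s - \<lfloor>x i / s\<rfloor>\<bar> \<le> 1" by linarith
        ultimately have "\<bar>x i - pt z i\<bar> \<le> s"
          using mult_left_mono[of "\<bar>x i / s - \<lfloor>x i / s\<rfloor>\<bar>" 1 s] \<open>0 < s\<close> by (simp add: abs_mult)
        then show ?thesis by (metis abs_ge_zero power2_abs power_mono)
      qed
      then have "(\<Sum>i<p. (x i - pt z i)\<^sup>2) \<le> p * s\<^sup>2"
        using sum_mono[of "{..<p}" "\<lambda>i. (x i - pt z i)\<^sup>2" "\<lambda>_. s\<^sup>2"] by simp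
      also have "p * s\<^sup>2 = d\<^sup>2" using \<open>0 < p\<close> by (simp add: s_def power_divide)
      finally show ?thesis
        unfolding norm_vec_def L2_set_def using \<open>0 < d\<close> by (intro real_le_lsqrt) (auto intro: sum_nonneg)
    qed
    ultimately show "\<exists>y\<in>N. norm_vec p (\<lambda>i. x i - y i) \<le> d" by blast
  qed
qed

context ridge_features
begin

text \<open>\<open>feature_cover\<close> at scale \<open>e / 2\<close> makes two members of a cell
  agree up to \<open>e\<close> on the grid. Moving to the nearest grid point costs another
  \<open>e\<close>: a difference of members has coefficients bounded by \<open>2 * B\<close>, which
  is the factor 2 in \<open>d\<close>.\<close>

lemma ball_cover:
  assumes "0 < B" "0 < e" "0 < p" "0 \<le> R" "0 < d" "0 < k" and d: "2 * (B * (L * B\<theta>)) * d \<le> e"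
    and k: "4 * (2 * R * sqrt p / d + 2) ^ p * exp (- (k * e\<^sup>2 / (128 * B\<^sup>2))) \<le> 1"
  obtains lab :: "(vec \<times> real \<Rightarrow> real) \<Rightarrow> (vec \<times> real \<Rightarrow> real)"
  where "finite (lab ` coeffs B)" "card (lab ` coeffs B) \<le> 2 * (8 * B / e + 3) ^ k"
    and "\<And>c c' x. c \<in> coeffs B \<Longrightarrow> c' \<in> coeffs B \<Longrightarrow> lab c = lab c' \<Longrightarrow> norm_vec p x \<le> R \<Longrightarrow>
           \<bar>F c x - F c' x\<bar> \<le> 2 * e"
proof -
  obtain N where N: "finite N" "card N \<le> (2 * R * sqrt p / d + 2) ^ p"
      and net: "\<And>x. norm_vec p x \<le> R \<Longrightarrow> \<exists>y\<in>N. norm_vec p (\<lambda>i. x i - y i) \<le> d"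
    using grid_net[of p R d] assms by blast
  define Z where "Z = (\<lambda>y \<theta>. \<phi> (arg y \<theta>)) ` N"
  have "card Z \<le> card N" unfolding Z_def by (rule card_image_le[OF N(1)])
  with N(2) have "real (card Z) \<le> (2 * R * sqrt p / d + 2) ^ p" by linarith
  then have "4 * real (card Z) * exp (- (k * e\<^sup>2 / (128 * B\<^sup>2)))
      \<le> 4 * (2 * R * sqrt p / d + 2) ^ p * exp (- (k * e\<^sup>2 / (128 * B\<^sup>2)))"
    by (intro mult_right_mono) auto
  with k have "4 * real (card Z) * exp (- (k * (e / 2)\<^sup>2 / (32 * B\<^sup>2))) \<le> 1"
    by (simp add: power_divide; linarith)
  then have card: "4 * card Z * exp (- (k * (e / 2)\<^sup>2 / (32 * B\<^sup>2))) \<le> 1" by simp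
  have Z: "y \<in> borel_measurable Q" "\<bar>y \<theta>\<bar> \<le> 1" if "y \<in> Z" for y \<theta>
    using that \<phi>_le unfolding Z_def by (blast intro: \<phi>_arg_measurable)+
  have K: "c \<in> borel_measurable Q" "\<bar>c \<theta>\<bar> \<le> B" if "c \<in> coeffs B" for c \<theta>
    using that unfolding coeffs_def by blast+
  have "finite Z" "0 < e / 2" unfolding Z_def using N(1) \<open>0 < e\<close> by simp_all
  obtain lab :: "(vec \<times> real \<Rightarrow> real) \<Rightarrow> (vec \<times> real \<Rightarrow> real)"
    where lab: "finite (lab ` coeffs B)" "card (lab ` coeffs B) \<le> 2 * (4 * B / (e / 2) + 3) ^ k"
      and sep: "\<And>c c'. c \<in> coeffs B \<Longrightarrow> c' \<in> coeffs B \<Longrightarrow> lab c = lab c' \<Longrightarrow>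
            \<not> feature_sep Q Z (2 * (e / 2)) c c'"
    by (rule feature_cover[OF prob_space_axioms \<open>finite Z\<close> \<open>0 < e / 2\<close> \<open>0 < B\<close> \<open>0 < k\<close> _ _ _ _ card,
          where K = "coeffs B"]) ((rule K Z, assumption) | blast)+
  show thesis
  proof (rule that[OF lab(1)])
    show "card (lab ` coeffs B) \<le> 2 * (8 * B / e + 3) ^ k" using lab(2) by simp
  next
    fix c c' x assume c: "c \<in> coeffs B" "c' \<in> coeffs B" "lab c = lab c'" and "norm_vec p x \<le> R"
    then obtain y where y: "y \<in> N" "norm_vec p (\<lambda>i. x i - y i) \<le> d" using net by blast
    have "\<bar>F c y - F c' y\<bar> \<le> e"
      using sep[OF c] y(1) by (auto simp: feature_sep_def Z_def F_def not_less)
    moreover have "\<bar>(F c x - F c' x) - (F c y - F c' y)\<bar> \<le> e"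
    proof -
      have "\<bar>(F c x - F c' x) - (F c y - F c' y)\<bar> \<le> 2 * B * (L * B\<theta>) * norm_vec p (\<lambda>i. x i - y i)"
        using F_lipschitz[OF coeffs_diff[OF c(1,2)], of x y] by (simp add: F_diff[OF c(1,2)])
      also have "\<dots> \<le> 2 * B * (L * B\<theta>) * d"
        using y(2) \<open>0 < B\<close> L_nonneg B\<theta>_nonneg by (intro mult_left_mono) auto
      finally show ?thesis using d by simp
    qed
    ultimately show "\<bar>F c x - F c' x\<bar> \<le> 2 * e" by linarith
  qed
qed

text \<open>The sum of the two distances dominates the Euclidean norm of the pair, in which the
  Lipschitz constant of \<open>h\<close> is measured.\<close>

definition gap :: "(vec \<times> real \<Rightarrow> real) \<Rightarrow> (vec \<times> real \<Rightarrow> real) \<Rightarrow> vec \<Rightarrow> real" where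
  "gap c c' x = norm_vec p (\<lambda>i. G c x i - G c' x i) + \<bar>F c x - F c' x\<bar>"

lemma gap_eq:
  assumes "c \<in> coeffs B" "c' \<in> coeffs B"
  shows "gap c c' x = norm_vec p (G (\<lambda>\<theta>. c \<theta> - c' \<theta>) x) + \<bar>F (\<lambda>\<theta>. c \<theta> - c' \<theta>) x\<bar>"
  unfolding gap_def F_diff[OF assms] using G_diff[OF assms] by (simp cong: norm_vec_cong)

lemma gap_le:
  assumes "c \<in> coeffs B" "c' \<in> coeffs B"
  shows "gap c c' x \<le> 2 * B * (1 + B\<theta> * L)"
  unfolding gap_eq[OF assms] using norm_G_le[OF coeffs_diff[OF assms], of x] abs_F_le[OF coeffs_diff[OF assms], of x]
  by (simp add: algebra_simps)

text \<open>
  In the next three lemmas, \<open>a\<close> and \<open>b\<close> are the scales, relative to the margin \<open>\<gamma>\<close>, of the functions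
  of the class and of their variation over \<open>S\<close>.
\<close>

lemma flat_cover:
  fixes \<gamma> Lh BS a b :: real
  assumes "0 < B" "0 < Lh" "0 < \<gamma>" and S: "\<And>x. x \<in> S \<Longrightarrow> norm_vec p x \<le> BS" "0 \<le> BS"
    and a_def: "a = B * Lh * (1 + B\<theta> * L) / \<gamma>" and a: "1 / 2 \<le> a"
    and b_def: "b = B * Lh * B\<theta> * (BS + 1) * (L + B\<theta> * L') / \<gamma>" and b: "b \<le> 1 / 8"
  obtains lab :: "(vec \<times> real \<Rightarrow> real) \<Rightarrow> int"
  where "finite (lab ` coeffs B)" "card (lab ` coeffs B) \<le> 8 * a"
    and "\<And>c c' x. c \<in> coeffs B \<Longrightarrow> c' \<in> coeffs B \<Longrightarrow> lab c = lab c' \<Longrightarrow> x \<in> S \<Longrightarrow> Lh * gap c c' x < \<gamma>"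
proof (cases "S = {}")
  case True
  have "card ((\<lambda>_::vec \<times> real \<Rightarrow> real. 0::int) ` coeffs B) \<le> 1"
    using card_mono[of "{0::int}" "(\<lambda>_. 0) ` coeffs B"] by auto
  then show thesis using True a by (intro that[of "\<lambda>_. 0"]) (auto intro: finite_subset[of _ "{0}"])
next
  case False
  then obtain x0 where x0: "x0 \<in> S" by blast
  \<comment> \<open>Only the value at \<open>x0\<close> is labelled, in cells of width
    \<open>\<gamma> / (2 * Lh)\<close>, so it uses up less than half of the margin. The variation
    over \<open>S\<close> and the gradients share the other half, thanks to
    \<open>b \<le> 1 / 8\<close>.\<close>
  define s where "s = 2 * Lh / \<gamma>"
  have "0 < s" unfolding s_def using assms by simp
  define lab where "lab c = \<lfloor>s * F c x0\<rfloor>" for c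
  have sB: "s * B \<le> 2 * a"
  proof -
    have "B * Lh * 1 \<le> B * Lh * (1 + B\<theta> * L)"
      using assms(1,2) B\<theta>_nonneg L_nonneg by (intro mult_left_mono) auto
    then have "2 * (B * Lh * 1) / \<gamma> \<le> 2 * (B * Lh * (1 + B\<theta> * L)) / \<gamma>"
      using \<open>0 < \<gamma>\<close> by (intro divide_right_mono) linarith+
    then show ?thesis unfolding s_def a_def by (simp add: mult_ac)
  qed
  have sub: "lab ` coeffs B \<subseteq> {\<lfloor>- (2 * a)\<rfloor>..\<lfloor>2 * a\<rfloor>}"
  proof (intro image_subsetI)
    fix c assume "c \<in> coeffs B"
    then have "\<bar>s * F c x0\<bar> \<le> s * B"
      using abs_F_le[of c B x0] \<open>0 < s\<close> by (simp add: abs_mult)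
    with sB have "- (2 * a) \<le> s * F c x0" "s * F c x0 \<le> 2 * a" by linarith+
    then show "lab c \<in> {\<lfloor>- (2 * a)\<rfloor>..\<lfloor>2 * a\<rfloor>}" unfolding lab_def by (auto intro: floor_mono)
  qed
  have "card (lab ` coeffs B) \<le> card {\<lfloor>- (2 * a)\<rfloor>..\<lfloor>2 * a\<rfloor>}" by (rule card_mono[OF _ sub]) simp
  \<comment> \<open>The interval has at most \<open>4 * a + 2\<close> integers, and
    \<open>1 / 2 \<le> a\<close> absorbs the 2.\<close>
  moreover have "real (card {\<lfloor>- (2 * a)\<rfloor>..\<lfloor>2 * a\<rfloor>}) \<le> 8 * a" using a by (simp; linarith)
  ultimately have card: "card (lab ` coeffs B) \<le> 8 * a" by linarith
  show thesis
  proof (rule that[OF finite_subset[OF sub] card])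
    fix c c' x assume c: "c \<in> coeffs B" "c' \<in> coeffs B" "lab c = lab c'" and x: "x \<in> S"
    define D where "D = F (\<lambda>\<theta>. c \<theta> - c' \<theta>)"
    define A where "A = B * (L * B\<theta>)"
    have "0 \<le> A" unfolding A_def using assms(1) L_nonneg B\<theta>_nonneg by simp
    have "\<bar>s * F c x0 - s * F c' x0\<bar> < 1"
      using c(3) unfolding lab_def by linarith
    then have "s * \<bar>D x0\<bar> < 1"
      using \<open>0 < s\<close> by (simp add: D_def F_diff[OF c(1,2)] abs_mult flip: right_diff_distrib)
    then have D0: "Lh * \<bar>D x0\<bar> < \<gamma> / 2" using \<open>0 < \<gamma>\<close> by (simp add: s_def field_simps)
    have "\<bar>D x - D x0\<bar> \<le> 2 * A * norm_vec p (\<lambda>i. x i - x0 i)"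
      using F_lipschitz[OF coeffs_diff[OF c(1,2)], of x x0] by (simp add: D_def A_def mult_ac)
    also have "\<dots> \<le> 2 * A * (2 * BS)"
      using S(1)[OF x] S(1)[OF x0] norm_vec_diff_le[of p x x0] \<open>0 \<le> A\<close> by (intro mult_left_mono) auto
    finally have "\<bar>D x\<bar> \<le> \<bar>D x0\<bar> + 4 * A * BS" by linarith
    moreover have "norm_vec p (G (\<lambda>\<theta>. c \<theta> - c' \<theta>) x) \<le> 2 * A"
      using norm_G_le[OF coeffs_diff[OF c(1,2)], of x] by (simp add: A_def)
    ultimately have "gap c c' x \<le> \<bar>D x0\<bar> + 4 * A * (BS + 1)"
      using \<open>0 \<le> A\<close> unfolding gap_eq[OF c(1,2)] D_def[symmetric] by (simp add: algebra_simps)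
    then have "Lh * gap c c' x \<le> Lh * (\<bar>D x0\<bar> + 4 * A * (BS + 1))"
      using assms(2) by (intro mult_left_mono) auto
    then have "Lh * gap c c' x \<le> Lh * \<bar>D x0\<bar> + 4 * (Lh * A * (BS + 1))"
      by (simp add: algebra_simps)
    moreover have "Lh * A * (BS + 1) \<le> b * \<gamma>"
    proof -
      have "B * Lh * B\<theta> * (BS + 1) * L \<le> B * Lh * B\<theta> * (BS + 1) * (L + B\<theta> * L')"
        using assms(1,2) S(2) B\<theta>_nonneg L'_nonneg by (intro mult_left_mono) auto
      then show ?thesis using \<open>0 < \<gamma>\<close> by (simp add: A_def b_def mult_ac)
    qed
    moreover have "b * \<gamma> \<le> 1 / 8 * \<gamma>" using b \<open>0 < \<gamma>\<close> by (intro mult_right_mono) auto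
    ultimately show "Lh * gap c c' x < \<gamma>" using D0 by linarith
  qed simp
qed

lemma steep_cover:
  fixes \<gamma> Lh BS a b :: real
  assumes "0 < B" "0 < p" "0 < Lh" "0 < \<gamma>"
    and S: "\<And>x. x \<in> S \<Longrightarrow> norm_vec p x \<le> BS" "0 \<le> BS"
    and a_def: "a = B * Lh * (1 + B\<theta> * L) / \<gamma>" and a: "1 / 2 \<le> a"
    and b_def: "b = B * Lh * B\<theta> * (BS + 1) * (L + B\<theta> * L') / \<gamma>" and b: "1 / 8 \<le> b"
    and "0 < k" and k: "(128 * 128 * 128) * (a * b)\<^sup>2 * (ln 4 + p * ln (1024 * b\<^sup>2 * p + 2)) \<le> k"
  obtains lab :: "(vec \<times> real \<Rightarrow> real) \<Rightarrow> (vec \<times> real \<Rightarrow> real)"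
  where "finite (lab ` coeffs B)" "card (lab ` coeffs B) \<le> 2 * (1024 * (a * b) + 3) ^ k"
    and "\<And>c c' x. c \<in> coeffs B \<Longrightarrow> c' \<in> coeffs B \<Longrightarrow> lab c = lab c' \<Longrightarrow> x \<in> S \<Longrightarrow> Lh * gap c c' x < \<gamma>"
proof -
  define U where "U = BS + 1"
  have U: "1 \<le> U" using S(2) by (simp add: U_def)
  note b_def = b_def[folded U_def]
  \<comment> \<open>\<open>A\<close> bounds at once the Lipschitz constant of members of the class
    and the constant of their Taylor remainder.\<close>
  define A where "A = b * \<gamma> / (Lh * U)"
  have A_eq: "A = B * B\<theta> * (L + B\<theta> * L')"
    unfolding A_def b_def using assms(3,4) U by simp
  have A1: "B * (L * B\<theta>) \<le> A" and A2: "B * (L' * B\<theta>\<^sup>2) \<le> A"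
    unfolding A_eq using assms(1) B\<theta>_nonneg L_nonneg L'_nonneg by (auto simp: algebra_simps power2_eq_square)
  \<comment> \<open>With the factor \<open>Lh\<close>, the interpolated gradient bound
    \<open>4 * e / r + 2 * A * r\<close> costs \<open>\<gamma> / (4 * U) + \<gamma> / 4\<close>, and
    the value bound \<open>2 * e\<close> costs
    \<open>\<gamma> / (64 * b) \<le> \<gamma> / 8\<close>; together this is at most five eighths of
    \<gamma>. The mesh \<open>d\<close> is chosen so that \<open>2 * A * d = e\<close>, and
    \<open>R\<close> leaves room for steps of length \<open>r\<close> starting in
    \<open>S\<close>.\<close>
  define r where "r = U / (8 * b)"
  define e where "e = \<gamma> / (128 * Lh * b)"
  define d where "d = U / (256 * b\<^sup>2)"
  define R where "R = BS + r"
  have pos: "0 < r" "0 < e" "0 < d" "0 < b" "0 \<le> R"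
    using b assms(3,4) S(2) U by (simp_all add: r_def e_def d_def R_def)
  have Ad: "2 * A * d = e"
    unfolding A_def d_def e_def using pos(4) assms(3,4) U by (simp add: power2_eq_square field_simps)
  have "2 * (B * (L * B\<theta>)) * d \<le> 2 * A * d"
    using A1 pos(3) by (intro mult_right_mono) simp_all
  with Ad have d: "2 * (B * (L * B\<theta>)) * d \<le> e" by simp
  have Be: "B / e \<le> 128 * (a * b)"
  proof -
    have "B * Lh * 1 \<le> B * Lh * (1 + B\<theta> * L)"
      using assms(1,3) B\<theta>_nonneg L_nonneg by (intro mult_left_mono) auto
    then have "B * Lh / \<gamma> \<le> a" unfolding a_def using \<open>0 < \<gamma>\<close> by (intro divide_right_mono) auto
    then have "128 * (B * Lh / \<gamma>) * b \<le> 128 * a * b" using pos(4) by (intro mult_right_mono) auto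
    then show ?thesis unfolding e_def using assms(3,4) pos(4) by (simp add: field_simps)
  qed
  define M where "M = 2 * R * sqrt p / d + 2"
  have M: "2 \<le> M" "M \<le> 1024 * b\<^sup>2 * p + 2"
  proof -
    show "2 \<le> M" unfolding M_def using pos by simp
    \<comment> \<open>The lower bound on \<open>b\<close> keeps the step \<open>r\<close> below
      \<open>U\<close>, so enlarging the ball at most doubles the radius \<open>U\<close>.\<close>
    have "U * 1 \<le> U * (8 * b)" using b U by (intro mult_left_mono) auto
    then have "r \<le> U" unfolding r_def using pos(4) by (simp add: pos_divide_le_eq)
    then have "R \<le> 2 * U" by (simp add: R_def U_def)
    moreover have "sqrt p \<le> p"
      using \<open>0 < p\<close> by (intro real_le_lsqrt) (auto simp: power2_eq_square mult_le_cancel_left1)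
    ultimately have "2 * R * sqrt p / d \<le> 2 * (2 * U) * p / d"
      using pos U by (intro divide_right_mono mult_mono) auto
    also have "\<dots> = 1024 * b\<^sup>2 * p" unfolding d_def using U pos(4) by (simp add: field_simps)
    finally show "M \<le> 1024 * b\<^sup>2 * p + 2" by (simp add: M_def)
  qed
  have hk: "4 * M ^ p * exp (- (k * e\<^sup>2 / (128 * B\<^sup>2))) \<le> 1"
  proof -
    have "ln (4 * M ^ p) = ln 4 + p * ln M" using M(1) by (simp add: ln_mult ln_realpow)
    also have "\<dots> \<le> ln 4 + p * ln (1024 * b\<^sup>2 * p + 2)"
      using M by (intro add_left_mono mult_left_mono) auto
    finally have lnM: "ln (4 * M ^ p) \<le> ln 4 + p * ln (1024 * b\<^sup>2 * p + 2)" .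
    have "1 \<le> M ^ p" using M(1) by (intro one_le_power) simp
    then have "0 \<le> ln (4 * M ^ p)" by (intro ln_ge_zero) simp
    \<comment> \<open>Squaring \<open>B / e \<le> 128 * (a * b)\<close> and multiplying by the 128
      in the exponent gives the cube of 128 in the bound on \<open>k\<close>.\<close>
    have "(B / e)\<^sup>2 \<le> (128 * (a * b))\<^sup>2"
      using Be assms(1) pos(2) by (intro power_mono) auto
    then have "128 * (B / e)\<^sup>2 * ln (4 * M ^ p)
        \<le> (128 * 128 * 128) * (a * b)\<^sup>2 * (ln 4 + p * ln (1024 * b\<^sup>2 * p + 2))"
      using lnM \<open>0 \<le> ln (4 * M ^ p)\<close> by - (rule mult_mono, simp_all add: power_mult_distrib)
    with k have "128 * (B / e)\<^sup>2 * ln (4 * M ^ p) \<le> k" by linarith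
    then have "ln (4 * M ^ p) \<le> k * e\<^sup>2 / (128 * B\<^sup>2)"
      using assms(1) pos(2) by (simp add: power_divide field_simps)
    then have "exp (ln (4 * M ^ p)) \<le> exp (k * e\<^sup>2 / (128 * B\<^sup>2))" by simp
    moreover have "exp (ln (4 * M ^ p)) = 4 * M ^ p" using M(1) by (intro exp_ln) simp
    ultimately have "4 * M ^ p \<le> exp (k * e\<^sup>2 / (128 * B\<^sup>2))" by simp
    then show ?thesis by (simp add: exp_minus field_simps)
  qed
  obtain lab :: "(vec \<times> real \<Rightarrow> real) \<Rightarrow> (vec \<times> real \<Rightarrow> real)"
    where lab: "finite (lab ` coeffs B)" "card (lab ` coeffs B) \<le> 2 * (8 * B / e + 3) ^ k"
    and near: "\<And>c c' x. c \<in> coeffs B \<Longrightarrow> c' \<in> coeffs B \<Longrightarrow> lab c = lab c' \<Longrightarrow> norm_vec p x \<le> R \<Longrightarrow>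
           \<bar>F c x - F c' x\<bar> \<le> 2 * e"
    using ball_cover[OF assms(1) pos(2) assms(2) pos(5) pos(3) \<open>0 < k\<close> d hk[unfolded M_def]] by blast
  show thesis
  proof (rule that[OF lab(1)])
    have "8 * B / e + 3 \<le> 1024 * (a * b) + 3" using Be by simp
    then have "(8 * B / e + 3) ^ k \<le> (1024 * (a * b) + 3) ^ k"
      using assms(1) pos(2) by (intro power_mono) auto
    with lab(2) show "card (lab ` coeffs B) \<le> 2 * (1024 * (a * b) + 3) ^ k" by linarith
  next
    fix c c' x assume c: "c \<in> coeffs B" "c' \<in> coeffs B" "lab c = lab c'" and x: "x \<in> S"
    have D: "\<bar>F (\<lambda>\<theta>. c \<theta> - c' \<theta>) y\<bar> \<le> 2 * e" if "norm_vec p (\<lambda>i. y i - x i) \<le> r" for y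
    proof -
      have "norm_vec p y \<le> R"
        using norm_vec_triangle[of p "\<lambda>i. y i - x i" x] that S(1)[OF x] by (simp add: R_def)
      then show ?thesis using near[OF c] by (simp add: F_diff[OF c(1,2)])
    qed
    have "norm_vec p (G (\<lambda>\<theta>. c \<theta> - c' \<theta>) x) \<le> 2 * (2 * e) / r + 2 * B * (L' * B\<theta>\<^sup>2) * r"
      by (rule interpolation_bound[OF coeffs_diff[OF c(1,2)] pos(1) D])
    also have "\<dots> \<le> 4 * e / r + 2 * A * r"
      using A2 pos(1) by (simp add: mult.assoc mult_right_mono)
    finally have "norm_vec p (G (\<lambda>\<theta>. c \<theta> - c' \<theta>) x) \<le> 4 * e / r + 2 * A * r" .
    moreover have "\<bar>F (\<lambda>\<theta>. c \<theta> - c' \<theta>) x\<bar> \<le> 2 * e"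
      by (rule D) (use pos(1) in \<open>simp add: norm_vec_def L2_set_def\<close>)
    ultimately have "gap c c' x \<le> 4 * e / r + 2 * A * r + 2 * e"
      unfolding gap_eq[OF c(1,2)] by linarith
    then have "Lh * gap c c' x \<le> Lh * (4 * e / r + 2 * A * r + 2 * e)"
      using assms(3) by (intro mult_left_mono) auto
    then have "Lh * gap c c' x \<le> Lh * (4 * e / r) + Lh * (2 * A * r) + Lh * (2 * e)"
      by (simp only: distrib_left)
    moreover have "Lh * (4 * e / r) = \<gamma> / (4 * U)"
      unfolding e_def r_def using assms(3) pos(4) U by (simp add: field_simps)
    moreover have "\<gamma> / (4 * U) \<le> \<gamma> / 4"
      using \<open>0 < \<gamma>\<close> U by (intro divide_left_mono) auto
    moreover have "Lh * (2 * A * r) = \<gamma> / 4"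
      unfolding A_def r_def using assms(3) pos(4) U by (simp add: field_simps)
    moreover have "Lh * (2 * e) = \<gamma> / (64 * b)"
      unfolding e_def using assms(3) pos(4) by (simp add: field_simps)
    moreover have "\<gamma> / (64 * b) \<le> \<gamma> / 8"
      using \<open>0 < \<gamma>\<close> b by (intro divide_left_mono) auto
    ultimately show "Lh * gap c c' x < \<gamma>" using \<open>0 < \<gamma>\<close> by linarith
  qed
qed

end

text \<open>By \<open>small\<close>, both logarithms have arguments that are at most a constant
  times \<open>n\<close>, hence are multiples of \<open>l\<close>: one bounds \<open>k\<close>, the
  other multiplies it. The lower bounds on \<open>a\<close>, \<open>b\<close> and \<open>l\<close>
  let additive constants be absorbed.\<close>

lemma log_cover_bound:
  fixes a b l :: real and n p k :: nat
  assumes "1 / 2 \<le> a" "1 / 8 \<le> b" "0 < p" "2 \<le> n"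
    and l: "l = log 2 n" and small: "(a * b)\<^sup>2 * p \<le> n"
    and k: "k \<le> (128 * 128 * 128) * (a * b)\<^sup>2 * (ln 4 + p * ln (1024 * b\<^sup>2 * p + 2)) + 1"
  shows "ln (2 * (1024 * (a * b) + 3) ^ k) \<le> 2 ^ 29 * ((a * b)\<^sup>2 * p * l ^ 3)"
proof -
  define Y where "Y = (a * b)\<^sup>2 * p"
  have l1: "1 \<le> l" unfolding l using \<open>2 \<le> n\<close> by (subst le_log_iff) auto
  have ab: "1 / 16 \<le> a * b" using mult_mono[OF assms(1,2)] assms(1) by simp
  have "(1 / 16)\<^sup>2 \<le> (a * b)\<^sup>2" using ab by (intro power_mono) auto
  then have ab2: "1 / 256 \<le> (a * b)\<^sup>2" by (simp add: power_one_over)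
  have p1: "1 \<le> real p" using \<open>0 < p\<close> by simp
  have ab2Y: "(a * b)\<^sup>2 \<le> Y" unfolding Y_def using p1 by (simp add: mult_le_cancel_left1)
  have ln_le: "ln x \<le> m + l" if "0 < x" "x \<le> 2 ^ m * n" for x :: real and m :: nat
  proof -
    have "ln x \<le> ln (2 ^ m * n)" using that by simp
    also have "\<dots> \<le> log 2 (2 ^ m * n)"
    proof -
      have "1 * 1 \<le> 2 ^ m * real n" using \<open>2 \<le> n\<close> by (intro mult_mono) auto
      then have "0 \<le> ln (2 ^ m * real n)" by (intro ln_ge_zero) simp
      then show ?thesis unfolding log_def using ln_2_less_1 ln_gt_zero[of "2 :: real"]
        by (simp add: pos_le_divide_eq mult_left_le)
    qed
    also have "\<dots> = m + l" unfolding l using \<open>2 \<le> n\<close> by (simp add: log_mult log_nat_power)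
    finally show ?thesis .
  qed
  have n1: "1 \<le> real n" using \<open>2 \<le> n\<close> by simp
  have abn: "a * b \<le> n"
  proof (rule power2_le_imp_le)
    have "(a * b)\<^sup>2 \<le> n" using ab2Y small unfolding Y_def by linarith
    also have "real n \<le> (real n)\<^sup>2" using n1 by (simp add: power2_eq_square mult_le_cancel_left1)
    finally show "(a * b)\<^sup>2 \<le> (real n)\<^sup>2" .
  qed simp
  have "ln (1024 * (a * b) + 3) \<le> 11 + l"
    using abn ab n1 ln_le[of "1024 * (a * b) + 3" 11] by simp
  then have ln1: "ln (1024 * (a * b) + 3) \<le> 12 * l" using l1 by linarith
  \<comment> \<open>The grid size involves \<open>b\<close> without \<open>a\<close>; the bound
    \<open>1 / 2 \<le> a\<close> removes \<open>a\<close> from \<open>small\<close>.\<close>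
  have "b\<^sup>2 * p \<le> 4 * n"
  proof -
    have "(1 / 2)\<^sup>2 \<le> a\<^sup>2" using assms(1) by (intro power_mono) auto
    then have "1 / 4 * (b\<^sup>2 * p) \<le> a\<^sup>2 * (b\<^sup>2 * p)" by (intro mult_right_mono) (auto simp: power2_eq_square)
    then show ?thesis using small by (simp add: power_mult_distrib mult.assoc)
  qed
  then have "ln (1024 * b\<^sup>2 * p + 2) \<le> 13 + l"
    using n1 ln_le[of "1024 * b\<^sup>2 * p + 2" 13] by (simp add: mult.assoc add_nonneg_pos)
  then have "ln (1024 * b\<^sup>2 * p + 2) \<le> 14 * l" using l1 by linarith
  then have "p * ln (1024 * b\<^sup>2 * p + 2) \<le> p * (14 * l)" by (rule mult_left_mono) simp
  moreover have "ln 4 \<le> 2 * (p * l)"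
  proof -
    have "ln 4 = 2 * ln (2 :: real)" using ln_realpow[of 2 2] by simp
    moreover have "1 \<le> p * l" using mult_mono[OF p1 l1] by simp
    ultimately show ?thesis using ln_2_less_1 by linarith
  qed
  ultimately have "ln 4 + p * ln (1024 * b\<^sup>2 * p + 2) \<le> 16 * (p * l)" by (simp add: algebra_simps)
  then have "(128 * 128 * 128) * (a * b)\<^sup>2 * (ln 4 + p * ln (1024 * b\<^sup>2 * p + 2))
      \<le> (128 * 128 * 128) * (a * b)\<^sup>2 * (16 * (p * l))"
    by (intro mult_left_mono) auto
  also have "\<dots> = 33554432 * (Y * l)" by (simp add: Y_def)
  finally have "k \<le> 33554432 * (Y * l) + 1" using k by linarith
  \<comment> \<open>This lower bound absorbs the 1 lost in rounding \<open>k\<close> up to an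
    integer.\<close>
  moreover have Yl: "1 \<le> 256 * (Y * l)"
    using mult_mono[of "1 / 256" Y 1 l] ab2 ab2Y l1 by simp
  ultimately have kY: "k \<le> 33554688 * (Y * l)" by linarith
  have "ln (2 * (1024 * (a * b) + 3) ^ k) = ln 2 + k * ln (1024 * (a * b) + 3)"
    using ab by (simp add: ln_mult ln_realpow)
  also have "\<dots> \<le> 1 + 33554688 * (Y * l) * (12 * l)"
    using ln_2_less_1 ln1 kY Yl l1 ab by (intro add_mono mult_mono) auto
  \<comment> \<open>The total \<open>402656256 + 256\<close> is rounded up to a power of two; this
    fixes the constant of the theorem.\<close>
  also have "\<dots> \<le> 2 ^ 29 * (Y * l * l)"
  proof -
    have "1 * 1 \<le> 256 * (Y * l) * l" using Yl l1 by (intro mult_mono) auto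
    then have "1 \<le> 256 * (Y * l * l)" by simp
    moreover have "33554688 * (Y * l) * (12 * l) = 402656256 * (Y * l * l)" by simp
    ultimately show ?thesis by simp
  qed
  also have "\<dots> \<le> 2 ^ 29 * (Y * l * l) * l"
  proof -
    have "0 \<le> Y * l" using Yl by linarith
    then have "0 \<le> Y * l * l" using l1 by - (rule mult_nonneg_nonneg, simp_all)
    then have "2 ^ 29 * (Y * l * l) * 1 \<le> 2 ^ 29 * (Y * l * l) * l"
      using l1 by (intro mult_left_mono) auto
    then show ?thesis by simp
  qed
  also have "\<dots> = 2 ^ 29 * ((a * b)\<^sup>2 * p * l ^ 3)" by (simp add: Y_def power3_eq_cube)
  finally show ?thesis .
qed

context ridge_features
begin

text \<open>If \<open>a < 1 / 2\<close>, any two members differ by less than the margin and one cell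
  suffices. If \<open>b \<le> 1 / 8\<close>, members are nearly constant on \<open>S\<close> and
  their value at one point decides; the summand \<open>a\<^sup>2 * l\<close> pays for this.
  Otherwise random features are used, paid for by \<open>b\<^sup>2 * p\<close>. Splitting off the
  small scales gives the lower bounds with which constants are absorbed.\<close>

lemma class_cover:
  fixes \<gamma> Lh BS a b l :: real and n :: nat
  assumes "0 < B" "0 < p" "0 \<le> Lh" "0 < \<gamma>"
    and S: "\<And>x. x \<in> S \<Longrightarrow> norm_vec p x \<le> BS" "0 \<le> BS"
    and a_def: "a = B * Lh * (1 + B\<theta> * L) / \<gamma>"
    and b_def: "b = B * Lh * B\<theta> * (BS + 1) * (L + B\<theta> * L') / \<gamma>"
    and "2 \<le> n" and l: "l = log 2 n" and small: "a\<^sup>2 * (a\<^sup>2 * l + b\<^sup>2 * p) * l ^ 3 \<le> n"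
  obtains lab :: "(vec \<times> real \<Rightarrow> real) \<Rightarrow> (vec \<times> real \<Rightarrow> real)"
  where "finite (lab ` coeffs B)"
    and "ln (card (lab ` coeffs B)) \<le> 2 ^ 29 * (a\<^sup>2 * (a\<^sup>2 * l + b\<^sup>2 * p) * l ^ 3)"
    and "\<And>c c' x. c \<in> coeffs B \<Longrightarrow> c' \<in> coeffs B \<Longrightarrow> lab c = lab c' \<Longrightarrow> x \<in> S \<Longrightarrow> Lh * gap c c' x < \<gamma>"
proof -
  have l1: "1 \<le> l" unfolding l using \<open>2 \<le> n\<close> by (subst le_log_iff) auto
  have l3: "1 \<le> l ^ 3" using l1 by (rule one_le_power)
  let ?T = "a\<^sup>2 * (a\<^sup>2 * l + b\<^sup>2 * p) * l ^ 3"
  have T0: "0 \<le> ?T" using l1 by (intro mult_nonneg_nonneg add_nonneg_nonneg) auto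
  have card_ln: "ln (card J) \<le> y" if "card J \<le> z" "ln z \<le> y" "0 \<le> y" for J :: "'z set" and y z :: real
  proof (cases "card J = 0")
    case False
    then have "ln (card J) \<le> ln z" using that(1) by (intro ln_mono) auto
    with that(2) show ?thesis by linarith
  qed (use that(3) in simp)
  consider "a < 1 / 2" | "1 / 2 \<le> a" "b \<le> 1 / 8" | "1 / 2 \<le> a" "1 / 8 \<le> b" by linarith
  then show thesis
  proof cases
    case 1
    have sub: "(\<lambda>_. (\<lambda>_. 0)) ` coeffs B \<subseteq> {\<lambda>_::vec \<times> real. 0::real}" by auto
    have "card ((\<lambda>_. (\<lambda>_::vec \<times> real. 0::real)) ` coeffs B) \<le> 1"
      using card_mono[OF _ sub] by simp
    then have card: "real (card ((\<lambda>_. (\<lambda>_::vec \<times> real. 0::real)) ` coeffs B)) \<le> 1" by simp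
    have "Lh * gap c c' x < \<gamma>" if c: "c \<in> coeffs B" "c' \<in> coeffs B" for c c' x
    proof -
      have "Lh * gap c c' x \<le> Lh * (2 * B * (1 + B\<theta> * L))"
        using gap_le[OF c] \<open>0 \<le> Lh\<close> by (rule mult_left_mono)
      also have "\<dots> = 2 * a * \<gamma>" using \<open>0 < \<gamma>\<close> by (simp add: a_def)
      also have "\<dots> < 1 * \<gamma>" using 1 \<open>0 < \<gamma>\<close> by (intro mult_strict_right_mono) auto
      finally show ?thesis by simp
    qed
    then show thesis
      using card_ln[OF card, of "2 ^ 29 * ?T"] T0
      by (intro that[of "\<lambda>_. (\<lambda>_. 0)"]) (auto intro: finite_subset[OF sub])
  next
    case 2
    have "Lh \<noteq> 0" using 2 a_def by auto
    with \<open>0 \<le> Lh\<close> have "0 < Lh" by simp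
    obtain lab :: "(vec \<times> real \<Rightarrow> real) \<Rightarrow> int"
      where lab: "finite (lab ` coeffs B)" "card (lab ` coeffs B) \<le> 8 * a"
        and near: "\<And>c c' x. c \<in> coeffs B \<Longrightarrow> c' \<in> coeffs B \<Longrightarrow> lab c = lab c' \<Longrightarrow> x \<in> S \<Longrightarrow>
              Lh * gap c c' x < \<gamma>"
      using flat_cover[OF \<open>0 < B\<close> \<open>0 < Lh\<close> \<open>0 < \<gamma>\<close> S a_def 2(1) b_def 2(2)] by blast
    \<comment> \<open>Integers are turned into constant functions so that all cases yield labels of
      the same type.\<close>
    define emb where "emb z = (\<lambda>_::vec \<times> real. real_of_int z)" for z
    have "inj emb" by (auto simp: inj_def emb_def fun_eq_iff)
    have img: "(\<lambda>c. emb (lab c)) ` coeffs B = emb ` lab ` coeffs B" by (simp add: image_image)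
    have "card ((\<lambda>c. emb (lab c)) ` coeffs B) \<le> card (lab ` coeffs B)"
      unfolding img by (rule card_image_le[OF lab(1)])
    with lab(2) have card: "real (card ((\<lambda>c. emb (lab c)) ` coeffs B)) \<le> 8 * a" by linarith
    have "ln (8 * a) \<le> 8 * a" using ln_le_minus_one[of "8 * a"] 2(1) by simp
    also have "\<dots> \<le> 64 * (a\<^sup>2 * a\<^sup>2)"
    proof -
      \<comment> \<open>The logarithm is wastefully raised to the fourth power of \<open>a\<close>,
        which is the form of the first summand of the complexity term.\<close>
      have "(1 / 2) ^ 3 \<le> a ^ 3" using 2(1) by (intro power_mono) auto
      then have "a * (1 / 8) \<le> a * a ^ 3" using 2(1) by (intro mult_left_mono) (auto simp: power_one_over)
      then show ?thesis by (simp add: power2_eq_square power3_eq_cube)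
    qed
    also have "\<dots> \<le> 2 ^ 29 * ?T"
    proof -
      have "a\<^sup>2 * 1 \<le> a\<^sup>2 * l" using l1 by (intro mult_left_mono) auto
      moreover have "0 \<le> b\<^sup>2 * p" by simp
      ultimately have "a\<^sup>2 \<le> a\<^sup>2 * l + b\<^sup>2 * p" by linarith
      then have "a\<^sup>2 * a\<^sup>2 \<le> a\<^sup>2 * (a\<^sup>2 * l + b\<^sup>2 * p)" by (intro mult_left_mono) auto
      then have "a\<^sup>2 * a\<^sup>2 * 1 \<le> ?T" using l3 by (rule mult_mono) (use l1 in auto)
      then have "64 * (a\<^sup>2 * a\<^sup>2) \<le> 64 * ?T" by simp
      also have "\<dots> \<le> 2 ^ 29 * ?T" using T0 by (intro mult_right_mono) auto
      finally show ?thesis .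
    qed
    finally have "ln (8 * a) \<le> 2 ^ 29 * ?T" .
    then have ln: "ln (card ((\<lambda>c. emb (lab c)) ` coeffs B)) \<le> 2 ^ 29 * ?T"
      by (rule card_ln[OF card]) (use T0 in simp)
    show thesis
    proof (rule that[OF _ ln])
      show "finite ((\<lambda>c. emb (lab c)) ` coeffs B)" unfolding img using lab(1) by simp
      fix c c' x assume "c \<in> coeffs B" "c' \<in> coeffs B" "emb (lab c) = emb (lab c')" "x \<in> S"
      with \<open>inj emb\<close> show "Lh * gap c c' x < \<gamma>" by (intro near) (auto dest: injD)
    qed
  next
    case 3
    have "Lh \<noteq> 0" using 3 a_def by auto
    with \<open>0 \<le> Lh\<close> have "0 < Lh" by simp
    define W where "W = (128 * 128 * 128) * (a * b)\<^sup>2 * (ln 4 + p * ln (1024 * b\<^sup>2 * p + 2))"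
    define k where "k = nat \<lceil>W\<rceil>"
    have "0 < ln 4 + p * ln (1024 * b\<^sup>2 * p + 2)" by (intro add_pos_nonneg) auto
    moreover have "0 < (a * b)\<^sup>2" using 3 by simp
    ultimately have "0 < W" unfolding W_def by (intro mult_pos_pos) auto
    then have k: "0 < k" "W \<le> k" "k \<le> W + 1" unfolding k_def by linarith+
    obtain lab :: "(vec \<times> real \<Rightarrow> real) \<Rightarrow> (vec \<times> real \<Rightarrow> real)"
      where lab: "finite (lab ` coeffs B)" "card (lab ` coeffs B) \<le> 2 * (1024 * (a * b) + 3) ^ k"
        and near: "\<And>c c' x. c \<in> coeffs B \<Longrightarrow> c' \<in> coeffs B \<Longrightarrow> lab c = lab c' \<Longrightarrow> x \<in> S \<Longrightarrow>
              Lh * gap c c' x < \<gamma>"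
      using steep_cover[OF \<open>0 < B\<close> \<open>0 < p\<close> \<open>0 < Lh\<close> \<open>0 < \<gamma>\<close> S a_def 3(1) b_def 3(2) k(1) k(2)[unfolded W_def]]
      by blast
    have part: "(a * b)\<^sup>2 * p * l ^ 3 \<le> ?T"
      using l1 by (intro mult_right_mono) (auto simp: power_mult_distrib algebra_simps)
    have "(a * b)\<^sup>2 * p * 1 \<le> (a * b)\<^sup>2 * p * l ^ 3" using l3 by (intro mult_left_mono) auto
    with part small have "(a * b)\<^sup>2 * p \<le> n" by linarith
    from log_cover_bound[OF 3 \<open>0 < p\<close> \<open>2 \<le> n\<close> l this k(3)[unfolded W_def]]
    have "ln (2 * (1024 * (a * b) + 3) ^ k) \<le> 2 ^ 29 * ((a * b)\<^sup>2 * p * l ^ 3)" .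
    also have "\<dots> \<le> 2 ^ 29 * ?T" using part by simp
    finally have "ln (2 * (1024 * (a * b) + 3) ^ k) \<le> 2 ^ 29 * ?T" .
    then have "ln (card (lab ` coeffs B)) \<le> 2 ^ 29 * ?T"
      by (rule card_ln[OF lab(2)]) (use T0 in simp)
    then show thesis using that lab(1) near by blast
  qed
qed

end

subsection \<open>Certificates as expectations of ridge features\<close>

text \<open>Where \<nu> vanishes, the extended quotient is infinite unless \<alpha> vanishes as
  well, so the domination extends to zeros of the density.\<close>

lemma abs_le_of_nu_norm_le:
  assumes "nu_norm \<Theta> \<nu> \<alpha> \<le> ennreal B" "\<theta> \<in> \<Theta>" "0 \<le> \<nu> \<theta>" "0 \<le> B"
  shows "\<bar>\<alpha> \<theta>\<bar> \<le> B * \<nu> \<theta>"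
proof -
  have le: "ennreal \<bar>\<alpha> \<theta>\<bar> / ennreal (\<nu> \<theta>) \<le> ennreal B"
    using assms(1,2) unfolding nu_norm_def by (meson SUP_le_iff)
  show ?thesis
  proof (cases "\<nu> \<theta> = 0")
    case True
    have "\<alpha> \<theta> = 0"
    proof (rule ccontr)
      assume "\<alpha> \<theta> \<noteq> 0"
      then have "ennreal \<bar>\<alpha> \<theta>\<bar> / ennreal (\<nu> \<theta>) = \<infinity>"
        using True by (simp add: ennreal_divide_eq_top_iff ennreal_eq_0_iff)
      with le show False by (simp add: top_unique)
    qed
    then show ?thesis using True by simp
  next
    case False
    with assms(3) have "0 < \<nu> \<theta>" by simp
    with le assms(4) have "\<bar>\<alpha> \<theta>\<bar> / \<nu> \<theta> \<le> B" by (simp add: divide_ennreal)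
    with \<open>0 < \<nu> \<theta>\<close> show ?thesis by (simp add: pos_divide_le_eq)
  qed
qed

text \<open>The indicator is part of the density because \<nu> is unconstrained outside \<Theta>: it
  may be negative there.\<close>

definition feature_measure ::
  "nat \<Rightarrow> (vec \<times> real) set \<Rightarrow> (vec \<times> real \<Rightarrow> real) \<Rightarrow> (vec \<times> real) measure" where
  "feature_measure p \<Theta> \<nu> = density (param_leb p) (\<lambda>\<theta>. ennreal (indicator \<Theta> \<theta> * \<nu> \<theta>))"

lemma prob_density_measurable:
  "prob_density_on p \<Theta> \<nu> \<Longrightarrow> (\<lambda>\<theta>. indicator \<Theta> \<theta> * \<nu> \<theta>) \<in> borel_measurable (param_leb p)"
  unfolding prob_density_on_def set_integrable_def
  by (auto dest!: borel_measurable_integrable)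

lemma prob_space_feature_measure:
  assumes "prob_density_on p \<Theta> \<nu>"
  shows "prob_space (feature_measure p \<Theta> \<nu>)"
proof
  let ?g = "\<lambda>\<theta>. indicator \<Theta> \<theta> * \<nu> \<theta>"
  have [measurable]: "?g \<in> borel_measurable (param_leb p)"
    by (rule prob_density_measurable[OF assms])
  have int: "integrable (param_leb p) ?g" and one: "integral\<^sup>L (param_leb p) ?g = 1"
    using assms by (auto simp: prob_density_on_def set_integrable_def set_lebesgue_integral_def)
  have nonneg: "0 \<le> ?g \<theta>" for \<theta>
    using assms by (auto simp: prob_density_on_def indicator_def)
  have "emeasure (feature_measure p \<Theta> \<nu>) (space (feature_measure p \<Theta> \<nu>))
      = (\<integral>\<^sup>+\<theta>. ennreal (?g \<theta>) \<partial>param_leb p)"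
    unfolding feature_measure_def by (subst emeasure_density) (auto intro!: nn_integral_cong)
  also have "\<dots> = ennreal 1"
    using nn_integral_eq_integral[OF int] nonneg one by simp
  finally show "emeasure (feature_measure p \<Theta> \<nu>) (space (feature_measure p \<Theta> \<nu>)) = 1" by simp
qed

lemma feature_measure_measurable:
  "borel_measurable (feature_measure p \<Theta> \<nu>) = borel_measurable (param_leb p)"
  unfolding feature_measure_def by (rule measurable_cong_sets) simp_all

lemma param_leb_coord_measurable: "i < p \<Longrightarrow> (\<lambda>\<theta>. fst \<theta> i) \<in> borel_measurable (param_leb p)"
  unfolding param_leb_def by (rule measurable_compose[OF measurable_fst]) simp

lemma param_leb_snd_measurable: "snd \<in> borel_measurable (param_leb p)"
  unfolding param_leb_def by simp

text \<open>Importance weighting: \<open>c = \<alpha> / \<nu>\<close> turns the Lebesgue integral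
  into an expectation under \<nu>, and the norm bound into a pointwise bound on
  \<open>c\<close>.\<close>

lemma V_class_coeffs:
  assumes ridge: "ridge_features (feature_measure p \<Theta> \<nu>) p \<Theta> \<phi> B\<theta> L L'"
    and dens: "prob_density_on p \<Theta> \<nu>" and "0 < B" and V: "V \<in> V_class p \<Theta> \<nu> \<phi> B"
  obtains c where "c \<in> ridge_features.coeffs (feature_measure p \<Theta> \<nu>) \<Theta> B"
    and "V = ridge_features.F (feature_measure p \<Theta> \<nu>) p \<phi> c"
proof -
  interpret ridge_features "feature_measure p \<Theta> \<nu>" p \<Theta> \<phi> B\<theta> L L' by (rule ridge)
  let ?g = "\<lambda>\<theta>. indicator \<Theta> \<theta> * \<nu> \<theta>"
  obtain \<alpha> where V_eq: "V = V_of p \<Theta> \<phi> \<alpha>" and "set_borel_measurable (param_leb p) \<Theta> \<alpha>"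
    and norm: "nu_norm \<Theta> \<nu> \<alpha> \<le> ennreal B"
    using V unfolding V_class_def by blast
  then have \<alpha>: "(\<lambda>\<theta>. indicator \<Theta> \<theta> * \<alpha> \<theta>) \<in> borel_measurable (param_leb p)"
    by (simp add: set_borel_measurable_def)
  have nonneg: "0 \<le> \<nu> \<theta>" if "\<theta> \<in> \<Theta>" for \<theta>
    using dens that by (auto simp: prob_density_on_def)
  have le: "\<bar>\<alpha> \<theta>\<bar> \<le> B * \<nu> \<theta>" if "\<theta> \<in> \<Theta>" for \<theta>
    using abs_le_of_nu_norm_le[OF norm that nonneg[OF that]] \<open>0 < B\<close> by simp
  \<comment> \<open>The indicators give measurability. Division by zero yields 0 outside \<Theta>
    and at zeros of \<nu>; at the latter \<alpha> vanishes too, so nothing is lost.\<close>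
  define c where "c = (\<lambda>\<theta>. (indicator \<Theta> \<theta> * \<alpha> \<theta>) / (indicator \<Theta> \<theta> * \<nu> \<theta>))"
  have "c \<in> borel_measurable (feature_measure p \<Theta> \<nu>)"
    unfolding c_def feature_measure_measurable
    by (intro borel_measurable_divide \<alpha> prob_density_measurable[OF dens])
  moreover have "\<bar>c \<theta>\<bar> \<le> B" for \<theta>
  proof (cases "\<theta> \<in> \<Theta> \<and> \<nu> \<theta> \<noteq> 0")
    case True
    then have "0 < \<nu> \<theta>" using nonneg[of \<theta>] by simp
    then show ?thesis using True le[of \<theta>] by (simp add: c_def abs_divide pos_divide_le_eq)
  qed (use \<open>0 < B\<close> in \<open>auto simp: c_def\<close>)
  moreover have "c \<theta> = 0" if "\<theta> \<notin> \<Theta>" for \<theta> using that by (simp add: c_def)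
  ultimately have c: "c \<in> coeffs B" unfolding coeffs_def by blast
  have "V x = F c x" for x
  proof -
    have "(\<lambda>\<theta>. c \<theta> * \<phi> (arg x \<theta>)) \<in> borel_measurable (param_leb p)"
      using borel_measurable_integrable[OF F_integrable[OF c, of x]] by (simp add: feature_measure_measurable)
    then have "F c x = (\<integral>\<theta>. ?g \<theta> *\<^sub>R (c \<theta> * \<phi> (arg x \<theta>)) \<partial>param_leb p)"
      unfolding F_def unfolding feature_measure_def
      by (intro integral_density prob_density_measurable[OF dens] AE_I2)
         (auto simp: indicator_def intro: nonneg)
    also have "\<dots> = V x"
      unfolding V_eq V_of_def set_lebesgue_integral_def
    proof (intro Bochner_Integration.integral_cong refl)
      fix \<theta>
      have "\<alpha> \<theta> = 0" if "\<theta> \<in> \<Theta>" "\<nu> \<theta> = 0" using le[OF that(1)] that(2) by simp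
      then show "?g \<theta> *\<^sub>R (c \<theta> * \<phi> (arg x \<theta>))
          = indicator \<Theta> \<theta> *\<^sub>R (\<alpha> \<theta> * \<phi> (inner_vec p x (fst \<theta>) + snd \<theta>))"
        by (cases "\<theta> \<in> \<Theta>") (simp_all add: c_def arg_def flip: mult.assoc)
    qed
    finally show ?thesis by simp
  qed
  then show thesis using that[OF c] by blast
qed

section \<open>Compactness of \<open>S\<close> and derivatives along trajectories\<close>

lemma bdd_above_norm_vec:
  assumes "compact S"
  shows "bdd_above (norm_vec p ` S)"
proof -
  have "continuous_on S (norm_vec p)"
    unfolding norm_vec_def L2_set_def
    by (intro continuous_intros continuous_on_subset[OF continuous_on_product_coordinates]) auto
  then show ?thesis
    by (intro bounded_imp_bdd_above compact_imp_bounded compact_continuous_image assms)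
qed

text \<open>This brings \<open>cert\<close> into the form \<open>h x (f x) v w\<close> to which
  \<open>Bh\<close> and \<open>Lh\<close> refer. In a nondegenerate interval every point is a limit
  point, so the derivative within \<open>T\<close> is unique, also at endpoints.\<close>

lemma time_deriv_solves_ivp:
  assumes T: "time_interval T" and sol: "solves_ivp p f T \<xi> x" and f: "f \<in> Rn p \<rightarrow> Rn p" and "t \<in> T"
  shows "time_deriv p T x t = f (x t)"
proof
  fix i
  have "connected T" using T by (simp add: time_interval_def is_interval_connected_1)
  moreover have "\<nexists>a. T = {a}" using T by (auto simp: time_interval_def)
  ultimately have "t islimpt T" using \<open>t \<in> T\<close> by (metis connected_imp_perfect)
  then have bot: "at t within T \<noteq> bot" by (simp add: trivial_limit_within)
  show "time_deriv p T x t i = f (x t) i"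
  proof (cases "i < p")
    case True
    then have "((\<lambda>s. x s i) has_vector_derivative f (x t) i) (at t within T)"
      using sol \<open>t \<in> T\<close> by (simp add: solves_ivp_def has_real_derivative_iff_has_vector_derivative)
    then show ?thesis using True bot by (simp add: time_deriv_def vector_derivative_within)
  next
    case False
    \<comment> \<open>From coordinate \<open>p\<close> on, both sides are
      \<open>undefined\<close>.\<close>
    have "f (x t) \<in> Rn p" using sol f \<open>t \<in> T\<close> by (auto simp: solves_ivp_def)
    then show ?thesis using False by (auto simp: time_deriv_def Rn_def PiE_def extensional_def)
  qed
qed

lemma grad_in_Rn: "grad p V x \<in> Rn p"
  by (simp add: grad_def Rn_def)

section \<open>From the cover of the class to the error bound\<close>

theorem theorem4p4:
  shows "\<exists>C>0. \<forall>(p::nat) (f :: vec \<Rightarrow> vec) (X :: vec set) (T :: real set)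
      (\<Phi> :: real \<Rightarrow> vec \<Rightarrow> vec) (D :: vec measure) (h :: vec \<Rightarrow> vec \<Rightarrow> real \<Rightarrow> vec \<Rightarrow> real)
      (\<Theta> :: (vec \<times> real) set) (\<nu> :: vec \<times> real \<Rightarrow> real) (\<phi> :: real \<Rightarrow> real) (S :: vec set)
      (B\<alpha>::real) (B\<theta>::real) (L\<phi>::real) (L\<phi>'::real) (BS::real)
      (BV::real) (BdV::real) (Bh::real) (Lh::real) (\<gamma>::real) (\<delta>::real) (n::nat).
    \<comment> \<open>dynamical system, initial conditions and certificate condition\<close>
      0 < p \<and>
      f \<in> Rn p \<rightarrow> Rn p \<and> continuous_on (Rn p) f \<and>
      X \<subseteq> Rn p \<and> compact X \<and>
      maximal_interval p f X T \<and>
      (\<forall>\<xi>\<in>X. solves_ivp p f T \<xi> (\<lambda>t. \<Phi> t \<xi>)) \<and>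
      prob_space D \<and> sets D = sets (restrict_space (\<Pi>\<^sub>M i\<in>{..<p}. borel) X) \<and>
      continuous_on (Rn p \<times> Rn p \<times> UNIV \<times> Rn p) (\<lambda>(x, y, v, w). h x y v w) \<and>
    \<comment> \<open>function class\<close>
      \<Theta> \<in> sets (param_leb p) \<and> prob_density_on p \<Theta> \<nu> \<and>
      0 < B\<alpha> \<and>
      (\<forall>s. \<bar>\<phi> s\<bar> \<le> 1) \<and> L\<phi>-lipschitz_on UNIV \<phi> \<and>
      (\<forall>s. \<phi> differentiable at s) \<and> L\<phi>'-lipschitz_on UNIV (deriv \<phi>) \<and>
      bdd_above (norm_pair p ` \<Theta>) \<and> B\<theta> = (SUP \<theta>\<in>\<Theta>. norm_pair p \<theta>) \<and>
    \<comment> \<open>compact set containing all trajectories\<close>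
      S \<subseteq> Rn p \<and> compact S \<and> (\<forall>\<xi>\<in>X. \<forall>t\<in>T. \<Phi> t \<xi> \<in> S) \<and>
      BS = (SUP x\<in>S. norm_vec p x) \<and>
    \<comment> \<open>constants\<close>
      (\<forall>V\<in>V_class p \<Theta> \<nu> \<phi> B\<alpha>. \<forall>x\<in>S. \<bar>V x\<bar> \<le> BV) \<and>
      (\<forall>V\<in>V_class p \<Theta> \<nu> \<phi> B\<alpha>. \<forall>x\<in>S. norm_vec p (grad p V x) \<le> BdV) \<and>
      (\<forall>x\<in>S. \<forall>v. \<forall>w\<in>Rn p. \<bar>v\<bar> \<le> BV \<and> norm_vec p w \<le> BdV \<longrightarrow> \<bar>h x (f x) v w\<bar> \<le> Bh) \<and>
      0 \<le> Lh \<and>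
      (\<forall>x\<in>S. \<forall>v v'. \<forall>w\<in>Rn p. \<forall>w'\<in>Rn p.
         \<bar>v\<bar> \<le> BV \<and> norm_vec p w \<le> BdV \<and> \<bar>v'\<bar> \<le> BV \<and> norm_vec p w' \<le> BdV \<longrightarrow>
         \<bar>h x (f x) v w - h x (f x) v' w'\<bar> \<le> Lh * norm_pair p (\<lambda>i. w i - w' i, v - v')) \<and>
      0 < \<gamma> \<and> 0 < \<delta> \<and> \<delta> < 1 \<and> 0 < n
    \<longrightarrow>
      (\<exists>E \<in> sets (\<Pi>\<^sub>M i\<in>{..<n}. D).
         measure (\<Pi>\<^sub>M i\<in>{..<n}. D) E \<ge> 1 - \<delta> \<and>
         (\<forall>\<xi>\<in>E. \<forall>V\<in>V_class p \<Theta> \<nu> \<phi> B\<alpha>.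
            (\<forall>i<n. \<forall>t\<in>T. cert p h T \<Phi> V (\<xi> i) t \<le> - \<gamma>) \<longrightarrow>
            err p h T \<Phi> D V \<le>
              C * (B\<alpha>\<^sup>2 * (1 + B\<theta> * L\<phi>)\<^sup>2 * Lh\<^sup>2 *
                     (kappa p n B\<alpha> Lh \<gamma> B\<theta> L\<phi> L\<phi>' BS * (log 2 n)^3 / (\<gamma>\<^sup>2 * n))
                   + log 2 (log 2 (1 + Bh / \<gamma>) / \<delta>) / n
                   + 1 / (real n)\<^sup>2)))"
proof -
  have main: "\<exists>E \<in> sets (\<Pi>\<^sub>M i\<in>{..<n}. D).
         measure (\<Pi>\<^sub>M i\<in>{..<n}. D) E \<ge> 1 - \<delta> \<and>
         (\<forall>\<xi>\<in>E. \<forall>V\<in>V_class p \<Theta> \<nu> \<phi> B\<alpha>.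
            (\<forall>i<n. \<forall>t\<in>T. cert p h T \<Phi> V (\<xi> i) t \<le> - \<gamma>) \<longrightarrow>
            err p h T \<Phi> D V \<le>
              2 ^ 29 * (B\<alpha>\<^sup>2 * (1 + B\<theta> * L\<phi>)\<^sup>2 * Lh\<^sup>2 *
                     (kappa p n B\<alpha> Lh \<gamma> B\<theta> L\<phi> L\<phi>' BS * (log 2 n)^3 / (\<gamma>\<^sup>2 * n))
                   + log 2 (log 2 (1 + Bh / \<gamma>) / \<delta>) / n
                   + 1 / (real n)\<^sup>2))"
    if "0 < p" and f: "f \<in> Rn p \<rightarrow> Rn p" and X: "X \<subseteq> Rn p"
      and maxi: "maximal_interval p f X T"
      and sol: "\<forall>\<xi>\<in>X. solves_ivp p f T \<xi> (\<lambda>t. \<Phi> t \<xi>)"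
      and D: "prob_space D" and sets_D: "sets D = sets (restrict_space (\<Pi>\<^sub>M i\<in>{..<p}. borel) X)"
      and dens: "prob_density_on p \<Theta> \<nu>" and "0 < B\<alpha>"
      and \<phi>: "\<forall>s. \<bar>\<phi> s\<bar> \<le> 1" "L\<phi>-lipschitz_on UNIV \<phi>" "\<forall>s. \<phi> differentiable at s"
        "L\<phi>'-lipschitz_on UNIV (deriv \<phi>)"
      and bdd: "bdd_above (norm_pair p ` \<Theta>)" and B\<theta>: "B\<theta> = (SUP \<theta>\<in>\<Theta>. norm_pair p \<theta>)"
      and "compact S" and \<Phi>: "\<forall>\<xi>\<in>X. \<forall>t\<in>T. \<Phi> t \<xi> \<in> S" and BS: "BS = (SUP x\<in>S. norm_vec p x)"
      and BV: "\<forall>V\<in>V_class p \<Theta> \<nu> \<phi> B\<alpha>. \<forall>x\<in>S. \<bar>V x\<bar> \<le> BV"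
      and BdV: "\<forall>V\<in>V_class p \<Theta> \<nu> \<phi> B\<alpha>. \<forall>x\<in>S. norm_vec p (grad p V x) \<le> BdV"
      and Bh: "\<forall>x\<in>S. \<forall>v. \<forall>w\<in>Rn p. \<bar>v\<bar> \<le> BV \<and> norm_vec p w \<le> BdV \<longrightarrow> \<bar>h x (f x) v w\<bar> \<le> Bh"
      and "0 \<le> Lh"
      and Lh: "\<forall>x\<in>S. \<forall>v v'. \<forall>w\<in>Rn p. \<forall>w'\<in>Rn p.
         \<bar>v\<bar> \<le> BV \<and> norm_vec p w \<le> BdV \<and> \<bar>v'\<bar> \<le> BV \<and> norm_vec p w' \<le> BdV \<longrightarrow>
         \<bar>h x (f x) v w - h x (f x) v' w'\<bar> \<le> Lh * norm_pair p (\<lambda>i. w i - w' i, v - v')"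
      and "0 < \<gamma>" "0 < \<delta>" "\<delta> < 1" "0 < n"
    for p :: nat and f :: "vec \<Rightarrow> vec" and X :: "vec set" and T :: "real set"
      and \<Phi> :: "real \<Rightarrow> vec \<Rightarrow> vec" and D :: "vec measure" and h :: "vec \<Rightarrow> vec \<Rightarrow> real \<Rightarrow> vec \<Rightarrow> real"
      and \<Theta> :: "(vec \<times> real) set" and \<nu> :: "vec \<times> real \<Rightarrow> real" and \<phi> :: "real \<Rightarrow> real" and S :: "vec set"
      and B\<alpha> B\<theta> L\<phi> L\<phi>' BS BV BdV Bh Lh \<gamma> \<delta> :: real and n :: nat
  proof -
    interpret D: prob_space D by (rule D)
    have space_D: "space D = X"
      using sets_eq_imp_space_eq[OF sets_D] X by (auto simp: space_restrict_space space_PiM Rn_def)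
    have T: "time_interval T" "0 \<in> T" using maxi by (auto simp: maximal_interval_def time_interval_def)
    have S: "norm_vec p x \<le> BS" if "x \<in> S" for x
      unfolding BS using bdd_above_norm_vec[OF \<open>compact S\<close>] that by (rule cSUP_upper[rotated])
    obtain \<xi>0 where "\<xi>0 \<in> X" using D.not_empty space_D by blast
    then have "\<Phi> 0 \<xi>0 \<in> S" using \<Phi> T(2) by blast
    from S[OF this] have "0 \<le> BS" using norm_vec_nonneg[of p "\<Phi> 0 \<xi>0"] by linarith
    have norm_\<Theta>: "norm_pair p \<theta> \<le> B\<theta>" if "\<theta> \<in> \<Theta>" for \<theta>
      unfolding B\<theta> using bdd that by (rule cSUP_upper[rotated])
    have "\<Theta> \<noteq> {}" using dens by (auto simp: prob_density_on_def set_lebesgue_integral_def)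
    then obtain \<theta>0 where "\<theta>0 \<in> \<Theta>" by blast
    from norm_\<Theta>[OF this] have "0 \<le> B\<theta>" by (rule order_trans[rotated]) (simp add: norm_pair_def)
    define Q where "Q = feature_measure p \<Theta> \<nu>"
    have ridge: "ridge_features Q p \<Theta> \<phi> B\<theta> L\<phi> L\<phi>'"
      unfolding ridge_features_def ridge_features_axioms_def Q_def feature_measure_measurable
      using prob_space_feature_measure[OF dens] param_leb_coord_measurable param_leb_snd_measurable
        norm_\<Theta> \<open>0 \<le> B\<theta>\<close> \<phi> by blast
    interpret ridge_features Q p \<Theta> \<phi> B\<theta> L\<phi> L\<phi>' by (rule ridge)
    define \<V> where "\<V> = V_class p \<Theta> \<nu> \<phi> B\<alpha>"
    \<comment> \<open>\<open>BV\<close> and \<open>BdV\<close> are assumed to bound the class only,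
      so the coefficients are restricted to those that represent a member of it. A labelling of all
      coefficients restricts to \<open>K\<close>.\<close>
    define K where "K = {c \<in> coeffs B\<alpha>. F c \<in> \<V>}"
    have rep: "\<exists>c\<in>K. V = F c" if "V \<in> \<V>" for V
      using V_class_coeffs[OF ridge[unfolded Q_def] dens \<open>0 < B\<alpha>\<close>] that unfolding K_def \<V>_def Q_def by blast

    have cert_eq: "cert p h T \<Phi> V \<xi> t = h (\<Phi> t \<xi>) (f (\<Phi> t \<xi>)) (V (\<Phi> t \<xi>)) (grad p V (\<Phi> t \<xi>))"
      if "\<xi> \<in> X" "t \<in> T" for V \<xi> t
      unfolding cert_def using time_deriv_solves_ivp[OF T(1) _ f that(2)] sol that(1) by metis
    have cert_close: "\<bar>cert p h T \<Phi> (F c) \<xi> t - cert p h T \<Phi> (F c') \<xi> t\<bar> \<le> Lh * gap c c' (\<Phi> t \<xi>)"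
      if c: "c \<in> K" "c' \<in> K" and \<xi>: "\<xi> \<in> X" "t \<in> T" for c c' \<xi> t
    proof -
      define x where "x = \<Phi> t \<xi>"
      have x: "x \<in> S" using \<Phi> \<xi> by (simp add: x_def)
      have "\<bar>cert p h T \<Phi> (F c) \<xi> t - cert p h T \<Phi> (F c') \<xi> t\<bar>
          \<le> Lh * norm_pair p (\<lambda>i. grad p (F c) x i - grad p (F c') x i, F c x - F c' x)"
        unfolding cert_eq[OF \<xi>] x_def[symmetric]
        using Lh x BV BdV c grad_in_Rn unfolding K_def \<V>_def by blast
      also have "\<dots> \<le> Lh * gap c c' x"
      proof (rule mult_left_mono[OF _ \<open>0 \<le> Lh\<close>])
        have "norm_vec p (\<lambda>i. grad p (F c) x i - grad p (F c') x i) = norm_vec p (\<lambda>i. G c x i - G c' x i)"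
          using c by (intro norm_vec_cong) (simp add: K_def grad_F[where B = B\<alpha>])
        then show "norm_pair p (\<lambda>i. grad p (F c) x i - grad p (F c') x i, F c x - F c' x) \<le> gap c c' x"
          unfolding gap_def by (metis norm_pair_le)
      qed
      finally show ?thesis by (simp add: x_def)
    qed
    have margin_le: "\<gamma> \<le> Bh" if "V \<in> \<V>" "\<xi> \<in> X" "cert p h T \<Phi> V \<xi> 0 \<le> - \<gamma>" for V \<xi>
    proof -
      have "\<bar>cert p h T \<Phi> V \<xi> 0\<bar> \<le> Bh"
        unfolding cert_eq[OF that(2) T(2)]
        using Bh BV BdV that(1,2) \<Phi> T(2) grad_in_Rn unfolding \<V>_def by blast
      with that(3) show ?thesis by linarith
    qed

    define a where "a = B\<alpha> * Lh * (1 + B\<theta> * L\<phi>) / \<gamma>"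
    define b where "b = B\<alpha> * Lh * B\<theta> * (BS + 1) * (L\<phi> + B\<theta> * L\<phi>') / \<gamma>"
    define l where "l = log 2 n"
    \<comment> \<open>\<open>\<tau> / n\<close> is the complexity term of the claim, see
      \<open>complexity\<close>.\<close>
    define \<tau> where "\<tau> = a\<^sup>2 * (a\<^sup>2 * l + b\<^sup>2 * p) * l ^ 3"
    define conf where "conf = log 2 (log 2 (1 + Bh / \<gamma>) / \<delta>)"
    have "0 \<le> l" using \<open>0 < n\<close> by (simp add: l_def zero_le_log_cancel_iff)
    then have "0 \<le> \<tau>" unfolding \<tau>_def by (intro mult_nonneg_nonneg add_nonneg_nonneg) auto
    have a2: "a\<^sup>2 = B\<alpha>\<^sup>2 * Lh\<^sup>2 * (1 + B\<theta> * L\<phi>)\<^sup>2 / \<gamma>\<^sup>2"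
      and b2: "b\<^sup>2 = B\<alpha>\<^sup>2 * Lh\<^sup>2 * B\<theta>\<^sup>2 * (BS + 1)\<^sup>2 * (L\<phi> + B\<theta> * L\<phi>')\<^sup>2 / \<gamma>\<^sup>2"
      by (simp_all add: a_def b_def power_mult_distrib power_divide)
    have "kappa p n B\<alpha> Lh \<gamma> B\<theta> L\<phi> L\<phi>' BS = a\<^sup>2 * l + b\<^sup>2 * p"
      unfolding kappa_def a2 b2 l_def by (simp add: distrib_left mult_ac)
    then have complexity: "B\<alpha>\<^sup>2 * (1 + B\<theta> * L\<phi>)\<^sup>2 * Lh\<^sup>2 *
        (kappa p n B\<alpha> Lh \<gamma> B\<theta> L\<phi> L\<phi>' BS * (log 2 n)^3 / (\<gamma>\<^sup>2 * n)) = \<tau> / n"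
      unfolding \<tau>_def a2 by (simp add: l_def)
    have conf: "ln (1 / \<delta>) \<le> conf" if "\<gamma> \<le> Bh"
    proof -
      have "1 \<le> Bh / \<gamma>" using that \<open>0 < \<gamma>\<close> by simp
      then have "1 \<le> log 2 (1 + Bh / \<gamma>)" by (subst le_log_iff) (linarith | simp)+
      then have "1 / \<delta> \<le> log 2 (1 + Bh / \<gamma>) / \<delta>" using \<open>0 < \<delta>\<close> by (intro divide_right_mono) auto
      then have "log 2 (1 / \<delta>) \<le> conf" unfolding conf_def using \<open>0 < \<delta>\<close> by (intro log_mono) auto
      moreover have "0 \<le> ln (1 / \<delta>)" using \<open>0 < \<delta>\<close> \<open>\<delta> < 1\<close> by (intro ln_ge_zero) auto
      then have "ln (1 / \<delta>) \<le> log 2 (1 / \<delta>)"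
        unfolding log_def using ln_2_less_1 ln_gt_zero[of "2 :: real"]
        by (simp add: pos_le_divide_eq mult_left_le)
      ultimately show ?thesis by linarith
    qed
    have ln_\<delta>: "0 < ln (1 / \<delta>)" using \<open>0 < \<delta>\<close> \<open>\<delta> < 1\<close> by (intro ln_gt_zero) auto
    have "\<exists>E \<in> sets (\<Pi>\<^sub>M i\<in>{..<n}. D). measure (\<Pi>\<^sub>M i\<in>{..<n}. D) E \<ge> 1 - \<delta> \<and>
         (\<forall>\<xi>\<in>E. \<forall>V\<in>\<V>. (\<forall>i<n. \<forall>t\<in>T. cert p h T \<Phi> V (\<xi> i) t \<le> - \<gamma>) \<longrightarrow>
            err p h T \<Phi> D V \<le> 2 ^ 29 * (\<tau> / n + conf / n + 1 / (real n)\<^sup>2))"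
    \<comment> \<open>In this case the right-hand side is at least 1, through
      \<open>1 / (real n)\<^sup>2\<close> or through \<open>\<tau> / n\<close>, and the whole sample
      space serves as \<open>E\<close>. Otherwise \<tau> is at most \<open>n\<close>, as the cover
      requires.\<close>
    proof (cases "n = 1 \<or> n < \<tau>")
      case True
      let ?P = "\<Pi>\<^sub>M i\<in>{..<n}. D"
      interpret P: prob_space ?P by (intro prob_space_PiM D)
      show ?thesis
      proof (intro bexI[of _ "space ?P"] conjI ballI impI)
        show "1 - \<delta> \<le> P.prob (space ?P)" using \<open>0 < \<delta>\<close> by (simp add: P.prob_space)
        fix \<xi> V assume \<xi>: "\<xi> \<in> space ?P" and V: "V \<in> \<V>"
          and feas: "\<forall>i<n. \<forall>t\<in>T. cert p h T \<Phi> V (\<xi> i) t \<le> - \<gamma>"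
        have "\<xi> 0 \<in> X" using \<xi> \<open>0 < n\<close> space_D by (auto simp: space_PiM)
        then have "0 \<le> conf" using margin_le[OF V] feas \<open>0 < n\<close> T(2) conf ln_\<delta> by force
        then have "0 \<le> conf / n" by simp
        moreover have "1 \<le> \<tau> / n + 1 / (real n)\<^sup>2"
        proof (cases "n = 1")
          case False
          with True have "1 \<le> \<tau> / n" using \<open>0 < n\<close> by (simp add: pos_le_divide_eq)
          moreover have "0 \<le> 1 / (real n)\<^sup>2" by simp
          ultimately show ?thesis by linarith
        qed (use \<open>0 \<le> \<tau>\<close> in simp)
        ultimately have "1 \<le> \<tau> / n + conf / n + 1 / (real n)\<^sup>2" by linarith
        then have "1 * 1 \<le> 2 ^ 29 * (\<tau> / n + conf / n + 1 / (real n)\<^sup>2)"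
          by - (rule mult_mono, simp_all)
        moreover have "err p h T \<Phi> D V \<le> 1" unfolding err_def by simp
        ultimately show "err p h T \<Phi> D V \<le> 2 ^ 29 * (\<tau> / n + conf / n + 1 / (real n)\<^sup>2)" by linarith
      qed simp
    next
      case False
      then have n: "2 \<le> n" and small: "a\<^sup>2 * (a\<^sup>2 * l + b\<^sup>2 * p) * l ^ 3 \<le> n"
        using \<open>0 < n\<close> by (auto simp: \<tau>_def)
      obtain lab :: "(vec \<times> real \<Rightarrow> real) \<Rightarrow> (vec \<times> real \<Rightarrow> real)"
        where fin: "finite (lab ` coeffs B\<alpha>)" and ln_card: "ln (card (lab ` coeffs B\<alpha>)) \<le> 2 ^ 29 * \<tau>"
          and near: "\<And>c c' x. c \<in> coeffs B\<alpha> \<Longrightarrow> c' \<in> coeffs B\<alpha> \<Longrightarrow> lab c = lab c' \<Longrightarrow> x \<in> S \<Longrightarrow>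
                Lh * gap c c' x < \<gamma>"
        using class_cover[OF \<open>0 < B\<alpha>\<close> \<open>0 < p\<close> \<open>0 \<le> Lh\<close> \<open>0 < \<gamma>\<close> S \<open>0 \<le> BS\<close> a_def b_def n l_def small]
        unfolding \<tau>_def by blast
      define N where "N = card (lab ` coeffs B\<alpha>)"
      \<comment> \<open>For positive \<open>N\<close> this solves
        \<open>N * exp (- r * n) = \<delta>\<close>. For \<open>N = 0\<close> the convention
        \<open>ln 0 = 0\<close> keeps \<open>r\<close> positive.\<close>
      define r where "r = (ln N + ln (1 / \<delta>)) / n"
      have "0 \<le> ln (real N)" by (cases "N = 0") auto
      then have "0 < r" unfolding r_def using ln_\<delta> \<open>0 < n\<close> by simp
      have labK: "lab ` K \<subseteq> lab ` coeffs B\<alpha>" by (auto simp: K_def)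
      have finK: "finite (lab ` K)" by (rule finite_subset[OF labK fin])
      have cardK: "card (lab ` K) \<le> N" unfolding N_def by (rule card_mono[OF fin labK])
      have "card (lab ` K) * exp (- r * n) \<le> N * exp (- r * n)"
        using cardK by (intro mult_right_mono) auto
      also have "\<dots> \<le> \<delta>"
      proof (cases "N = 0")
        case False
        have "- r * n = ln (\<delta> / N)"
          unfolding r_def using False \<open>0 < n\<close> \<open>0 < \<delta>\<close> by (simp add: ln_div)
        then show ?thesis using False \<open>0 < \<delta>\<close> by simp
      qed (use \<open>0 < \<delta>\<close> in simp)
      finally have rN: "card (lab ` K) * exp (- r * n) \<le> \<delta>" .
      define Pos where "Pos c = {\<xi>\<in>space D. (SUP t\<in>T. cert p h T \<Phi> (F c) \<xi> t) > 0}" for c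
      define Bad where "Bad c = {\<xi>. \<not> (\<forall>t\<in>T. cert p h T \<Phi> (F c) \<xi> t \<le> - \<gamma>)}" for c
      have sub: "Pos c \<subseteq> Bad c'" if c: "c \<in> K" "c' \<in> K" "lab c = lab c'" for c c'
      proof
        fix \<xi> assume \<xi>: "\<xi> \<in> Pos c"
        \<comment> \<open>Arguing by contradiction, \<open>cSUP_least\<close> needs only that
          \<open>T\<close> is nonempty, not that the supremum is attained.\<close>
        have "\<exists>t\<in>T. 0 < cert p h T \<Phi> (F c) \<xi> t"
        proof (rule ccontr)
          assume "\<not> ?thesis"
          then have "(SUP t\<in>T. cert p h T \<Phi> (F c) \<xi> t) \<le> 0"
            using T(2) by (intro cSUP_least) (auto simp: not_less)
          with \<xi> show False by (simp add: Pos_def)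
        qed
        then obtain t where t: "t \<in> T" "0 < cert p h T \<Phi> (F c) \<xi> t" ..
        have "\<xi> \<in> X" using \<xi> space_D by (simp add: Pos_def)
        then have "Lh * gap c c' (\<Phi> t \<xi>) < \<gamma>" using near c \<Phi> t(1) unfolding K_def by blast
        then have "- \<gamma> < cert p h T \<Phi> (F c') \<xi> t"
          using cert_close[OF c(1,2) \<open>\<xi> \<in> X\<close> t(1)] t(2) by linarith
        then show "\<xi> \<in> Bad c'" using t(1) unfolding Bad_def by (auto simp: not_le)
      qed
      obtain E where E: "E \<in> sets (\<Pi>\<^sub>M i\<in>{..<n}. D)" "1 - \<delta> \<le> measure (\<Pi>\<^sub>M i\<in>{..<n}. D) E"
        and gen: "\<And>\<xi> c. \<xi> \<in> E \<Longrightarrow> c \<in> K \<Longrightarrow> (\<And>i. i < n \<Longrightarrow> \<xi> i \<notin> Bad c) \<Longrightarrow> D.prob (Pos c) < r"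
        using label_generalization[where Pos = Pos and Bad = Bad, OF D finK \<open>0 < r\<close> rN sub] by blast
      show ?thesis
      proof (intro bexI[OF _ E(1)] conjI E(2) ballI impI)
        fix \<xi> V assume \<xi>: "\<xi> \<in> E" and V: "V \<in> \<V>"
          and feas: "\<forall>i<n. \<forall>t\<in>T. cert p h T \<Phi> V (\<xi> i) t \<le> - \<gamma>"
        have "\<xi> \<in> space (\<Pi>\<^sub>M i\<in>{..<n}. D)" using sets.sets_into_space[OF E(1)] \<xi> by blast
        then have "\<xi> 0 \<in> X" using \<open>0 < n\<close> space_D by (auto simp: space_PiM)
        then have "ln (1 / \<delta>) \<le> conf" using margin_le[OF V] feas \<open>0 < n\<close> T(2) conf by blast
        obtain c where c: "c \<in> K" "V = F c" using rep[OF V] by blast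
        have "err p h T \<Phi> D V = D.prob (Pos c)" by (simp add: err_def Pos_def c(2))
        also have "\<dots> \<le> r" using gen[OF \<xi> c(1)] feas by (force simp: Bad_def c(2))
        \<comment> \<open>The confidence term is at least \<open>ln (1 / \<delta>)\<close>, hence
          positive, and may be inflated to share the constant of the complexity term.\<close>
        also have "r \<le> (2 ^ 29 * \<tau> + 2 ^ 29 * conf) / n"
          unfolding r_def using ln_card \<open>ln (1 / \<delta>) \<le> conf\<close> ln_\<delta>
          by (intro divide_right_mono) (simp_all add: N_def)
        also have "\<dots> \<le> 2 ^ 29 * (\<tau> / n + conf / n + 1 / (real n)\<^sup>2)"
          by (simp add: add_divide_distrib distrib_left)
        finally show "err p h T \<Phi> D V \<le> 2 ^ 29 * (\<tau> / n + conf / n + 1 / (real n)\<^sup>2)" .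
      qed
    qed
    then show ?thesis unfolding complexity \<V>_def conf_def .
  qed
  show ?thesis
    by (intro exI[of _ "2 ^ 29 :: real"] conjI allI impI, simp, elim conjE, rule main; assumption)
qed

end
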